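(* Let $m,p\ge 1$ be integers. Let $\mathcal{M}$ be a closed subspace of $H^2_{\mathbb{C}^m}(\mathbb{D})$ that is nearly $S^*$-invariant with defect $p$, with $p$-dimensional defect space $\mathcal{F}$ (orthogonal to $\mathcal{M}$), and let $\{E_1,\dots,E_p\}$ be any orthonormal basis of $\mathcal{F}$. Let $\{W_1,\dots,W_r\}$ be an orthonormal basis of $\mathcal{W}:=\mathcal{M}\ominus(\mathcal{M}\cap zH^2_{\mathbb{C}^m}(\mathbb{D}))$ and let $F_0$ be the $m\times r$ matrix-valued function whose columns are $W_1,\dots,W_r$. Then: (i) If there are functions in $\mathcal{M}$ that do not vanish at $0$, then there is a closed subspace $\mathcal{K}$ of $H^2_{\mathbb{C}^{r+p}}(\mathbb{D})=H^2_{\mathbb{C}^r}(\mathbb{D})\times H^2_{\mathbb{C}}(\mathbb{D})\times\cdots\times H^2_{\mathbb{C}}(\mathbb{D})$ ($p$ scalar factors), invariant under $S^*\oplus\cdots\oplus S^*$ (the backward shift of $H^2_{\mathbb{C}^{r+p}}(\mathbb{D})$), such that $$\mathcal{M}=\Big\{F:\ F(z)=F_0(z)K_0(z)+\sum_{j=1}^{p}z\,k_j(z)E_j(z),\ (K_0,k_1,\dots,k_p)\in\mathcal{K}\Big\},$$ and $\|F\|^2=\|K_0\|^2+\sum_{j=1}^p\|k_j\|^2$ for all $(K_0,k_1,\dots,k_p)\in\mathcal{K}$ and the corresponding $F$. (ii) If all functions in $\mathcal{M}$ vanish at $0$, then there is a closed $S^*\oplus\cdots\oplus S^*$-invariant subspace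 $\mathcal{K}$ of $H^2_{\mathbb{C}^{p}}(\mathbb{D})$ such that $$\mathcal{M}=\Big\{F:\ F(z)=\sum_{j=1}^{p}z\,k_j(z)E_j(z),\ (k_1,\dots,k_p)\in\mathcal{K}\Big\},$$ and $\|F\|^2=\sum_{j=1}^p\|k_j\|^2$ for all $(k_1,\dots,k_p)\in\mathcal{K}$ and the corresponding $F$. Conversely, let $\mathcal{M}$ be a closed subspace of $H^2_{\mathbb{C}^m}(\mathbb{D})$, let $\{W_1,\dots,W_r\}$ be an orthonormal basis of $\mathcal{M}\ominus(\mathcal{M}\cap zH^2_{\mathbb{C}^m}(\mathbb{D}))$, let $F_0$ be the matrix with columns $W_1,\dots,W_r$, and let $\{E_1,\dots,E_p\}$ be an orthonormal basis of a $p$-dimensional subspace $\mathcal{F}$ orthogonal to $\mathcal{M}$. If $\mathcal{M}$ has a representation as described in (i) (with functions in $\mathcal{M}$ not vanishing at $0$) or as described in (ii) (with all functions in $\mathcal{M}$ vanishing at $0$), for some closed backward-shift-invariant subspace $\mathcal{K}$ as there, then $\mathcal{M}$ is nearly $S^*$-invariant with defect $p$.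
   Context: $H^2_{\mathbb{C}^m}(\mathbb{D})$ is the Hilbert space of $\mathbb{C}^m$-valued analytic functions $F(z)=\sum_{n\ge0}A_nz^n$ on the unit disc $\mathbb{D}$ with $\|F\|^2=\sum_n\|A_n\|^2<\infty$. $S$ is the shift $(SF)(z)=zF(z)$ and $S^*$ its adjoint, the backward shift $(S^*F)(z)=(F(z)-F(0))/z$. A closed subspace $\mathcal{M}\subset H^2_{\mathbb{C}^m}(\mathbb{D})$ is nearly $S^*$-invariant with defect $p$ if there is a $p$-dimensional subspace $\mathcal{F}\subset H^2_{\mathbb{C}^m}(\mathbb{D})$, orthogonal to $\mathcal{M}$ (the defect space), such that $F\in\mathcal{M}$ and $F(0)=0$ imply $S^*F\in\mathcal{M}\oplus\mathcal{F}$. The dimension $p$ is not required to be minimal. *)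

theory Defs
  imports "HOL-Complex_Analysis.Complex_Analysis"
begin

no_notation fps_nth (infixl \<open>$\<close> 75)  (* clashes with vec_nth *)

section \<open>The vector-valued Hardy space of the unit disc\<close>

definition has_taylor :: "(complex \<Rightarrow> complex ^ 'n) \<Rightarrow> (nat \<Rightarrow> complex ^ 'n) \<Rightarrow> bool" where
  "has_taylor F A \<longleftrightarrow> (\<forall>z\<in>ball 0 1. (\<lambda>k. z ^ k *s A k) sums F z)"

text \<open>A function on the disc is encoded as a total function that vanishes off the disc, so that
  equality of total functions is equality on the disc.\<close>

definition hardy_fun :: "(complex \<Rightarrow> complex ^ 'n) \<Rightarrow> bool" where
  "hardy_fun F \<longleftrightarrow> (\<exists>A. has_taylor F A \<and> summable (\<lambda>k. (norm (A k))\<^sup>2)) \<and>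
     (\<forall>z. z \<notin> ball 0 1 \<longrightarrow> F z = 0)"

lemma hardy_fun_zero: "hardy_fun (\<lambda>_. 0)"
  unfolding hardy_fun_def has_taylor_def by (auto intro!: exI[of _ "\<lambda>_. 0"])

typedef 'n hardy = "{F :: complex \<Rightarrow> complex ^ 'n::finite. hardy_fun F}"
  morphisms hval Abs_hardy
  using hardy_fun_zero by blast

setup_lifting type_definition_hardy

definition hcoeff :: "'n::finite hardy \<Rightarrow> nat \<Rightarrow> complex ^ 'n" where
  "hcoeff F = (THE A. has_taylor (hval F) A)"

lemma sums_vec_iff:
  fixes f :: "nat \<Rightarrow> complex ^ 'n"
  shows "f sums a \<longleftrightarrow> (\<forall>i. (\<lambda>k. f k $ i) sums (a $ i))"
proof
  assume "\<forall>i. (\<lambda>k. f k $ i) sums (a $ i)"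
  thus "f sums a" unfolding sums_def by (intro vec_tendstoI) simp
qed (auto intro: sums_vec_nth)

lemma has_taylor_unique:
  assumes "has_taylor F A" "has_taylor F B"
  shows "A = B"
proof -
  have "A k $ i = B k $ i" for k i
  proof -
    have *: "(\<lambda>z. F z $ i) has_fps_expansion Abs_fps (\<lambda>k. C k $ i)" if "has_taylor F C" for C
    proof (rule has_fps_expansionI)
      have "eventually (\<lambda>z::complex. z \<in> ball 0 1) (nhds 0)"
        by (rule eventually_nhds_in_open) auto
      thus "\<forall>\<^sub>F u in nhds 0. (\<lambda>n. fps_nth (Abs_fps (\<lambda>k. C k $ i)) n * u ^ n) sums F u $ i"
      proof eventually_elim
        case (elim z)
        hence "(\<lambda>k. z ^ k *s C k) sums F z"
          using that by (simp add: has_taylor_def)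
        hence "(\<lambda>k. (z ^ k *s C k) $ i) sums (F z $ i)"
          by (rule sums_vec_nth)
        thus ?case by (simp add: mult.commute)
      qed
    qed
    have "Abs_fps (\<lambda>k. A k $ i) = Abs_fps (\<lambda>k. B k $ i)"
      by (rule fps_expansion_unique_complex[OF *[OF assms(1)] *[OF assms(2)]])
    thus ?thesis by (simp add: fps_eq_iff)
  qed
  thus ?thesis by (simp add: fun_eq_iff vec_eq_iff)
qed

lemma hardy_fun_hval: "hardy_fun (hval F)"
  using hval by blast

lemma hcoeff_eqI: "has_taylor (hval F) A \<Longrightarrow> hcoeff F = A"
  unfolding hcoeff_def using has_taylor_unique by (intro the_equality) auto

lemma has_taylor_hcoeff: "has_taylor (hval F) (hcoeff F)"
  using hardy_fun_hval[of F] hcoeff_eqI[of F] unfolding hardy_fun_def by auto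

lemma summable_hcoeff: "summable (\<lambda>k. (norm (hcoeff F k))\<^sup>2)"
  using hardy_fun_hval[of F] hcoeff_eqI[of F] unfolding hardy_fun_def by auto

lemma hval_outside: "z \<notin> ball 0 1 \<Longrightarrow> hval F z = 0"
  using hardy_fun_hval[of F] unfolding hardy_fun_def by auto

lemma hval_sums: "z \<in> ball 0 1 \<Longrightarrow> (\<lambda>k. z ^ k *s hcoeff F k) sums hval F z"
  using has_taylor_hcoeff[of F] unfolding has_taylor_def by auto

lemma hcoeff_0: "hcoeff F 0 = hval F 0"
proof -
  have "(\<lambda>k. (0::complex) ^ k *s hcoeff F k) sums hcoeff F 0"
    using sums_single[of 0 "hcoeff F"]
    by (rule sums_cong[THEN iffD1, rotated]) (auto simp: vec_eq_iff power_0_left)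
  thus ?thesis using hval_sums[of 0 F] sums_unique2 by auto
qed

lemma hardy_eqI:
  assumes "\<And>k. hcoeff F k = hcoeff G k"
  shows "F = G"
proof -
  have "hval F z = hval G z" for z
  proof (cases "z \<in> ball 0 1")
    case True
    thus ?thesis using hval_sums[OF True, of F] hval_sums[OF True, of G] assms sums_unique2 by auto
  qed (simp add: hval_outside)
  thus ?thesis by (simp add: hval_inject[symmetric] fun_eq_iff)
qed

lemma hardy_funI:
  assumes "has_taylor F A" "summable (\<lambda>k. (norm (A k))\<^sup>2)" "\<And>z. z \<notin> ball 0 1 \<Longrightarrow> F z = 0"
  shows "hardy_fun F"
  using assms unfolding hardy_fun_def by auto

lemma summable_norm_add:
  fixes A B :: "nat \<Rightarrow> complex ^ 'n"
  assumes "summable (\<lambda>k. (norm (A k))\<^sup>2)" "summable (\<lambda>k. (norm (B k))\<^sup>2)"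
  shows "summable (\<lambda>k. (norm (A k + B k))\<^sup>2)"
proof (rule summable_comparison_test)
  show "summable (\<lambda>k. 2 * (norm (A k))\<^sup>2 + 2 * (norm (B k))\<^sup>2)"
    using assms by (intro summable_add summable_mult)
  have "(norm (a + b))\<^sup>2 \<le> 2 * (norm a)\<^sup>2 + 2 * (norm b)\<^sup>2" for a b :: "complex ^ 'n"
  proof -
    have "(norm (a + b))\<^sup>2 \<le> (norm a + norm b)\<^sup>2"
      by (intro power_mono norm_triangle_ineq) auto
    also have "\<dots> \<le> 2 * (norm a)\<^sup>2 + 2 * (norm b)\<^sup>2"
      using sum_squares_bound[of "norm a" "norm b"] by (simp add: power2_sum)
    finally show ?thesis .
  qed
  thus "\<exists>N. \<forall>k\<ge>N. norm ((norm (A k + B k))\<^sup>2) \<le> 2 * (norm (A k))\<^sup>2 + 2 * (norm (B k))\<^sup>2"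
    by auto
qed

lemma norm_vector_scalar_mult: "norm (c *s (v :: complex ^ 'n)) = cmod c * norm v"
  by (simp add: norm_vec_def norm_mult L2_set_right_distrib)

subsection \<open>Vector space structure\<close>

lemma has_taylor_scale:
  assumes "has_taylor F A"
  shows "has_taylor (\<lambda>z. c *s F z) (\<lambda>k. c *s A k)"
  unfolding has_taylor_def sums_vec_iff
proof (intro ballI allI)
  fix z :: complex and i assume "z \<in> ball 0 1"
  hence "(\<lambda>k. z ^ k *s A k) sums F z"
    using assms by (simp only: has_taylor_def)
  hence "(\<lambda>k. c * (z ^ k *s A k) $ i) sums (c * F z $ i)"
    by (intro sums_mult sums_vec_nth)
  thus "(\<lambda>k. (z ^ k *s (c *s A k)) $ i) sums ((c *s F z) $ i)"
    by (simp add: mult_ac)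
qed

lemma has_taylor_add:
  assumes "has_taylor F A" "has_taylor G B"
  shows "has_taylor (\<lambda>z. F z + G z) (\<lambda>k. A k + B k)"
  unfolding has_taylor_def
proof
  fix z :: complex assume z: "z \<in> ball 0 1"
  have "(\<lambda>k. z ^ k *s A k + z ^ k *s B k) sums (F z + G z)"
    using assms z by (intro sums_add) (simp_all only: has_taylor_def)
  thus "(\<lambda>k. z ^ k *s (A k + B k)) sums (F z + G z)"
    by (simp only: vector_add_ldistrib)
qed

lemma hardy_fun_add:
  assumes "hardy_fun F" "hardy_fun G"
  shows "hardy_fun (\<lambda>z. F z + G z)"
proof -
  obtain A where A: "has_taylor F A" "summable (\<lambda>k. (norm (A k))\<^sup>2)"
      "\<And>z. z \<notin> ball 0 1 \<Longrightarrow> F z = 0"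
    using assms(1) unfolding hardy_fun_def by blast
  obtain B where B: "has_taylor G B" "summable (\<lambda>k. (norm (B k))\<^sup>2)"
      "\<And>z. z \<notin> ball 0 1 \<Longrightarrow> G z = 0"
    using assms(2) unfolding hardy_fun_def by blast
  show ?thesis
    using A(3) B(3)
    by (intro hardy_funI[OF has_taylor_add[OF A(1) B(1)] summable_norm_add[OF A(2) B(2)]]) simp
qed

lemma hardy_fun_scale:
  assumes "hardy_fun F"
  shows "hardy_fun (\<lambda>z. c *s F z)"
proof -
  obtain A where A: "has_taylor F A" "summable (\<lambda>k. (norm (A k))\<^sup>2)"
      "\<And>z. z \<notin> ball 0 1 \<Longrightarrow> F z = 0"
    using assms unfolding hardy_fun_def by blast
  have "summable (\<lambda>k. (norm (c *s A k))\<^sup>2)"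
    unfolding norm_vector_scalar_mult power_mult_distrib using A(2) by (rule summable_mult)
  thus ?thesis
    using A(3) by (intro hardy_funI[OF has_taylor_scale[OF A(1)]]) simp_all
qed

instantiation hardy :: (finite) ab_group_add
begin

lift_definition zero_hardy :: "'a hardy" is "\<lambda>_. 0" by (rule hardy_fun_zero)

lift_definition plus_hardy :: "'a hardy \<Rightarrow> 'a hardy \<Rightarrow> 'a hardy" is "\<lambda>F G z. F z + G z"
  by (rule hardy_fun_add)

lift_definition uminus_hardy :: "'a hardy \<Rightarrow> 'a hardy" is "\<lambda>F z. - F z"
proof -
  fix F :: "complex \<Rightarrow> complex ^ 'a" assume "hardy_fun F"
  from hardy_fun_scale[OF this, of "- 1"] show "hardy_fun (\<lambda>z. - F z)"
    by simp
qed

definition minus_hardy :: "'a hardy \<Rightarrow> 'a hardy \<Rightarrow> 'a hardy" where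
  "minus_hardy F G = F + (- G)"

instance
proof
  fix F G H :: "'a hardy"
  show "F + G + H = F + (G + H)" by transfer (simp add: add.assoc)
  show "F + G = G + F" by transfer (simp add: add.commute)
  show "0 + F = F" by transfer simp
  show "- F + F = 0" by transfer simp
  show "F - G = F + - G" by (rule minus_hardy_def)
qed

end

lift_definition hscale :: "complex \<Rightarrow> 'n::finite hardy \<Rightarrow> 'n hardy" is "\<lambda>c F z. c *s F z"
  by (rule hardy_fun_scale)

global_interpretation hardy: vector_space hscale
proof
  fix a b :: complex and F G :: "'n::finite hardy"
  show "hscale a (F + G) = hscale a F + hscale a G"
    by transfer (simp add: vector_add_ldistrib)
  show "hscale (a + b) F = hscale a F + hscale b F"
    by transfer (simp add: fun_eq_iff vec_eq_iff distrib_right)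
  show "hscale a (hscale b F) = hscale (a * b) F"
    by transfer (simp add: vector_smult_assoc)
  show "hscale 1 F = F"
    by transfer simp
qed

lemma hcoeff_zero: "hcoeff 0 = (\<lambda>_. 0)"
  by (rule hcoeff_eqI) (auto simp: has_taylor_def zero_hardy.rep_eq)

lemma hcoeff_add: "hcoeff (F + G) = (\<lambda>k. hcoeff F k + hcoeff G k)"
  by (rule hcoeff_eqI)
     (use has_taylor_add[OF has_taylor_hcoeff[of F] has_taylor_hcoeff[of G]] in
       \<open>simp add: plus_hardy.rep_eq\<close>)

lemma hcoeff_scale: "hcoeff (hscale c F) = (\<lambda>k. c *s hcoeff F k)"
  by (rule hcoeff_eqI)
     (use has_taylor_scale[OF has_taylor_hcoeff[of F], of c] in \<open>simp add: hscale.rep_eq\<close>)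

instantiation hardy :: (finite) real_vector
begin

definition scaleR_hardy :: "real \<Rightarrow> 'a hardy \<Rightarrow> 'a hardy" where
  "scaleR_hardy c F = hscale (of_real c) F"

instance
  by standard
     (simp_all add: scaleR_hardy_def hardy.scale_right_distrib hardy.scale_left_distrib)

end

lemma hcoeff_scaleR: "hcoeff (c *\<^sub>R F) = (\<lambda>k. c *\<^sub>R hcoeff F k)"
  by (simp add: scaleR_hardy_def hcoeff_scale fun_eq_iff vec_eq_iff scaleR_conv_of_real[where 'a = complex])

subsection \<open>Inner product, norm and topology\<close>

lemma summable_inner_hcoeff: "summable (\<lambda>k. inner (hcoeff F k) (hcoeff G k))"
proof (rule summable_comparison_test)
  show "summable (\<lambda>k. (norm (hcoeff F k))\<^sup>2 + (norm (hcoeff G k))\<^sup>2)"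
    by (intro summable_add summable_hcoeff)
  have "\<bar>inner a b\<bar> \<le> (norm a)\<^sup>2 + (norm b)\<^sup>2" for a b :: "complex ^ 'a"
  proof -
    have "2 * norm a * norm b \<le> (norm a)\<^sup>2 + (norm b)\<^sup>2"
      by (rule sum_squares_bound)
    moreover have "0 \<le> norm a * norm b" by simp
    ultimately show ?thesis using Cauchy_Schwarz_ineq2[of a b] by linarith
  qed
  thus "\<exists>N. \<forall>k\<ge>N. norm (inner (hcoeff F k) (hcoeff G k))
      \<le> (norm (hcoeff F k))\<^sup>2 + (norm (hcoeff G k))\<^sup>2"
    by auto
qed

text \<open>The class below only provides the real inner product, which is the real part of
  \<open>hinner\<close>; orthogonality in the statement always refers to \<open>hinner\<close>.\<close>

instantiation hardy :: (finite) real_inner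
begin

definition norm_hardy :: "'a hardy \<Rightarrow> real" where
  "norm_hardy F = sqrt (\<Sum>k. (norm (hcoeff F k))\<^sup>2)"

definition inner_hardy :: "'a hardy \<Rightarrow> 'a hardy \<Rightarrow> real" where
  "inner_hardy F G = (\<Sum>k. inner (hcoeff F k) (hcoeff G k))"

definition sgn_hardy :: "'a hardy \<Rightarrow> 'a hardy" where
  "sgn_hardy F = F /\<^sub>R norm F"

definition dist_hardy :: "'a hardy \<Rightarrow> 'a hardy \<Rightarrow> real" where
  "dist_hardy F G = norm (F - G)"

definition uniformity_hardy :: "('a hardy \<times> 'a hardy) filter" where
  "uniformity_hardy = (INF e\<in>{0<..}. principal {(F, G). dist F G < e})"

definition open_hardy :: "'a hardy set \<Rightarrow> bool" where
  "open_hardy U \<longleftrightarrow> (\<forall>F\<in>U. eventually (\<lambda>(F', G). F' = F \<longrightarrow> G \<in> U) uniformity)"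

instance
proof
  fix F G H :: "'a hardy" and a :: real
  show "dist F G = norm (F - G)" "sgn F = F /\<^sub>R norm F"
    by (fact dist_hardy_def sgn_hardy_def)+
  show "inner F G = inner G F" by (simp add: inner_hardy_def inner_commute)
  show "inner (F + G) H = inner F H + inner G H"
    by (simp add: inner_hardy_def hcoeff_add inner_add_left suminf_add summable_inner_hcoeff)
  show "inner (a *\<^sub>R F) G = a * inner F G"
    by (simp add: inner_hardy_def hcoeff_scaleR suminf_mult summable_inner_hcoeff)
  show "0 \<le> inner F F"
    by (simp add: inner_hardy_def suminf_nonneg summable_inner_hcoeff)
  show "(inner F F = 0) = (F = 0)"
  proof
    assume "inner F F = 0"
    hence "\<forall>k. inner (hcoeff F k) (hcoeff F k) = 0"
      unfolding inner_hardy_def by (subst (asm) suminf_eq_zero_iff) (auto intro: summable_inner_hcoeff)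
    thus "F = 0" by (intro hardy_eqI) (simp add: hcoeff_zero)
  qed (simp add: inner_hardy_def hcoeff_zero)
  show "norm F = sqrt (inner F F)"
    by (simp add: norm_hardy_def inner_hardy_def power2_norm_eq_inner)
qed (fact uniformity_hardy_def open_hardy_def)+

end

definition hinner :: "'n::finite hardy \<Rightarrow> 'n hardy \<Rightarrow> complex" where
  "hinner F G = (\<Sum>k. \<Sum>i\<in>UNIV. hcoeff F k $ i * cnj (hcoeff G k $ i))"

lemma summable_hinner:
  "summable (\<lambda>k. \<Sum>i\<in>UNIV. hcoeff F k $ i * cnj (hcoeff G k $ i))"
proof (intro summable_sum, rule summable_comparison_test)
  fix i
  show "summable (\<lambda>k. (norm (hcoeff F k))\<^sup>2 + (norm (hcoeff G k))\<^sup>2)"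
    by (intro summable_add summable_hcoeff)
  have "norm (a $ i * cnj (b $ i)) \<le> (norm a)\<^sup>2 + (norm b)\<^sup>2" for a b :: "complex ^ 'a"
  proof -
    have "norm (a $ i * cnj (b $ i)) \<le> norm a * norm b"
      by (auto simp: norm_mult intro!: mult_mono Finite_Cartesian_Product.norm_nth_le)
    moreover have "2 * norm a * norm b \<le> (norm a)\<^sup>2 + (norm b)\<^sup>2"
      by (rule sum_squares_bound)
    moreover have "0 \<le> norm a * norm b" by simp
    ultimately show ?thesis by linarith
  qed
  thus "\<exists>N. \<forall>k\<ge>N. norm (hcoeff F k $ i * cnj (hcoeff G k $ i))
      \<le> (norm (hcoeff F k))\<^sup>2 + (norm (hcoeff G k))\<^sup>2"
    by auto
qed

lemma inner_eq_Re_hinner: "inner F G = Re (hinner F G)"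
  unfolding inner_hardy_def hinner_def
  by (subst Re_suminf[OF summable_hinner])
     (simp add: inner_vec_def inner_complex_def)

definition horth_basis :: "('i::finite \<Rightarrow> 'n::finite hardy) \<Rightarrow> 'n hardy set \<Rightarrow> bool" where
  "horth_basis E V \<longleftrightarrow>
     (\<forall>i j. hinner (E i) (E j) = (if i = j then 1 else 0)) \<and> hardy.span (range E) = V"

definition horthogonal :: "'n::finite hardy set \<Rightarrow> 'n hardy set \<Rightarrow> bool" where
  "horthogonal V V' \<longleftrightarrow> (\<forall>F\<in>V. \<forall>G\<in>V'. hinner F G = 0)"

definition hominus :: "'n::finite hardy set \<Rightarrow> 'n hardy set \<Rightarrow> 'n hardy set"  (infixl \<open>\<ominus>\<close> 65) where
  "V \<ominus> V' = {F \<in> V. \<forall>G\<in>V'. hinner F G = 0}"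

subsection \<open>Shift and backward shift\<close>

lemma has_taylor_hshift:
  assumes "has_taylor F A"
  shows "has_taylor (\<lambda>z. z *s F z) (\<lambda>k. if k = 0 then 0 else A (k - 1))" (is "has_taylor _ ?B")
  unfolding has_taylor_def sums_vec_iff
proof (intro ballI allI)
  fix z :: complex and i assume "z \<in> ball 0 1"
  hence "(\<lambda>k. z ^ k * A k $ i) sums (F z $ i)"
    using assms by (auto simp: has_taylor_def sums_vec_iff)
  hence "(\<lambda>k. z * (z ^ k * A k $ i)) sums (z * F z $ i)" by (rule sums_mult)
  hence "(\<lambda>k. (z ^ Suc k *s ?B (Suc k)) $ i) sums ((z *s F z) $ i)" by (simp add: mult.assoc)
  thus "(\<lambda>k. (z ^ k *s ?B k) $ i) sums ((z *s F z) $ i)"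
    by (subst (asm) sums_Suc_iff) simp
qed

lift_definition hshift :: "'n::finite hardy \<Rightarrow> 'n hardy" is "\<lambda>F z. z *s F z"
proof -
  fix F :: "complex \<Rightarrow> complex ^ 'n" assume "hardy_fun F"
  then obtain A where A: "has_taylor F A" "summable (\<lambda>k. (norm (A k))\<^sup>2)"
      "\<And>z. z \<notin> ball 0 1 \<Longrightarrow> F z = 0"
    unfolding hardy_fun_def by blast
  let ?B = "\<lambda>k. if k = 0 then 0 else A (k - 1)"
  have "summable (\<lambda>k. (norm (?B k))\<^sup>2)"
    by (subst summable_Suc_iff[symmetric]) (use A(2) in simp)
  thus "hardy_fun (\<lambda>z. z *s F z)"
    using A has_taylor_hshift[OF A(1)] by (intro hardy_funI[of _ ?B]) auto
qed

lemma has_taylor_hbshift: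
  assumes A: "has_taylor F A"
  shows "has_taylor (\<lambda>z. if z \<notin> ball 0 1 then 0
         else if z = 0 then (\<chi> i. deriv (\<lambda>w. F w $ i) 0)
         else inverse z *s (F z - F 0)) (\<lambda>k. A (Suc k))" (is "has_taylor ?G _")
proof -
  have s: "(\<lambda>k. z ^ k * A k $ i) sums (F z $ i)" if "z \<in> ball 0 1" for z i
    using A that by (auto simp: has_taylor_def sums_vec_iff)
  have z0: "A 0 $ i = F 0 $ i" for i
    using s[of 0 i] powser_sums_zero_iff[of "\<lambda>k. A k $ i" "F 0 $ i"] by (simp add: mult.commute)
  have d: "deriv (\<lambda>w. F w $ i) 0 = A 1 $ i" for i
  proof -
    have "eventually (\<lambda>z::complex. z \<in> ball 0 1) (nhds 0)"
      by (rule eventually_nhds_in_open) auto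
    hence "(\<lambda>w. F w $ i) has_fps_expansion Abs_fps (\<lambda>k. A k $ i)"
      by (intro has_fps_expansionI, eventually_elim) (use s in \<open>auto simp: mult.commute\<close>)
    from fps_nth_fps_expansion[OF this, of 1] show ?thesis by simp
  qed
  show ?thesis
    unfolding has_taylor_def sums_vec_iff
  proof (intro ballI allI)
    fix z :: complex and i assume z: "z \<in> ball 0 1"
    show "(\<lambda>k. (z ^ k *s A (Suc k)) $ i) sums (?G z $ i)"
    proof (cases "z = 0")
      case True
      thus ?thesis
        using d[of i] powser_sums_zero[of "\<lambda>k. A (Suc k) $ i"] by (simp add: mult.commute)
    next
      case False
      have "(\<lambda>k. z ^ Suc k * A (Suc k) $ i) sums (F z $ i - F 0 $ i)"
        using s[OF z, of i] z0[of i] by (subst sums_Suc_iff) simp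
      hence "(\<lambda>k. inverse z * (z ^ Suc k * A (Suc k) $ i)) sums (inverse z * (F z $ i - F 0 $ i))"
        by (rule sums_mult)
      moreover have "inverse z * (z ^ Suc k * A (Suc k) $ i) = z ^ k * A (Suc k) $ i" for k
        using False by (simp add: field_simps)
      ultimately have "(\<lambda>k. z ^ k * A (Suc k) $ i) sums (inverse z * (F z $ i - F 0 $ i))"
        by (simp only:)
      moreover have "?G z = inverse z *s (F z - F 0)" using z False by simp
      ultimately show ?thesis by (simp only: vector_smult_component vector_minus_component)
    qed
  qed
qed

text \<open>The quotient \<open>(F(z) - F(0)) / z\<close> has a removable singularity at \<open>0\<close>, where its value is the
  derivative of \<open>F\<close>.\<close>

lift_definition hbshift :: "'n::finite hardy \<Rightarrow> 'n hardy" is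
  "\<lambda>F z. if z \<notin> ball 0 1 then 0
         else if z = 0 then (\<chi> i. deriv (\<lambda>w. F w $ i) 0)
         else inverse z *s (F z - F 0)"
proof -
  fix F :: "complex \<Rightarrow> complex ^ 'n" assume "hardy_fun F"
  then obtain A where A: "has_taylor F A" "summable (\<lambda>k. (norm (A k))\<^sup>2)"
    unfolding hardy_fun_def by blast
  have "summable (\<lambda>k. (norm (A (Suc k)))\<^sup>2)"
    using A(2) by (subst summable_Suc_iff)
  thus "hardy_fun (\<lambda>z. if z \<notin> ball 0 1 then 0
         else if z = 0 then (\<chi> i. deriv (\<lambda>w. F w $ i) 0)
         else inverse z *s (F z - F 0))"
    by (intro hardy_funI[OF has_taylor_hbshift[OF A(1)]]) auto
qed

lemma hcoeff_hshift: "hcoeff (hshift F) = (\<lambda>k. if k = 0 then 0 else hcoeff F (k - 1))"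
  by (rule hcoeff_eqI)
     (use has_taylor_hshift[OF has_taylor_hcoeff[of F]] in \<open>simp add: hshift.rep_eq\<close>)

lemma hcoeff_hbshift: "hcoeff (hbshift F) = (\<lambda>k. hcoeff F (Suc k))"
  by (rule hcoeff_eqI)
     (use has_taylor_hbshift[OF has_taylor_hcoeff[of F]] in \<open>simp add: hbshift.rep_eq\<close>)

lemma hinner_hshift: "hinner (hshift F) G = hinner F (hbshift G)"
proof -
  have "hinner (hshift F) G = (\<Sum>k. \<Sum>i\<in>UNIV. hcoeff (hshift F) (Suc k) $ i * cnj (hcoeff G (Suc k) $ i))"
    unfolding hinner_def
    by (subst suminf_split_head[OF summable_hinner]) (simp add: hcoeff_hshift)
  thus ?thesis by (simp add: hinner_def hcoeff_hshift hcoeff_hbshift)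
qed

subsection \<open>Components\<close>

lift_definition hcomp :: "('a \<Rightarrow> 'b) \<Rightarrow> 'b::finite hardy \<Rightarrow> 'a::finite hardy" is
  "\<lambda>f K z. \<chi> i. K z $ f i"
proof -
  fix f :: "'a \<Rightarrow> 'b" and F :: "complex \<Rightarrow> complex ^ 'b" assume "hardy_fun F"
  then obtain A where A: "has_taylor F A" "summable (\<lambda>k. (norm (A k))\<^sup>2)"
      "\<And>z. z \<notin> ball 0 1 \<Longrightarrow> F z = 0"
    unfolding hardy_fun_def by blast
  let ?B = "\<lambda>k. \<chi> i. A k $ f i"
  have "has_taylor (\<lambda>z. \<chi> i. F z $ f i) ?B"
    unfolding has_taylor_def sums_vec_iff
  proof (intro ballI allI)
    fix z :: complex and i :: 'a assume "z \<in> ball 0 1"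
    hence "(\<lambda>k. z ^ k *s A k) sums F z"
      using A(1) by (simp only: has_taylor_def)
    from sums_vec_nth[OF this, of "f i"]
    show "(\<lambda>k. (z ^ k *s ?B k) $ i) sums ((\<chi> i. F z $ f i) $ i)" by simp
  qed
  moreover have "summable (\<lambda>k. (norm (?B k))\<^sup>2)"
  proof (rule summable_comparison_test)
    show "summable (\<lambda>k. real CARD('a) * (norm (A k))\<^sup>2)"
      using A(2) by (rule summable_mult)
    have "(norm (?B k))\<^sup>2 \<le> real CARD('a) * (norm (A k))\<^sup>2" for k
    proof -
      have "(norm (?B k))\<^sup>2 = (\<Sum>i\<in>UNIV. (norm (A k $ f i))\<^sup>2)"
        by (simp add: norm_vec_def L2_set_def sum_nonneg)
      also have "\<dots> \<le> (\<Sum>i\<in>(UNIV::'a set). (norm (A k))\<^sup>2)"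
        by (intro sum_mono power_mono Finite_Cartesian_Product.norm_nth_le) auto
      finally show ?thesis by simp
    qed
    thus "\<exists>N. \<forall>k\<ge>N. norm ((norm (?B k))\<^sup>2) \<le> real CARD('a) * (norm (A k))\<^sup>2" by auto
  qed
  ultimately show "hardy_fun (\<lambda>z. \<chi> i. F z $ f i)"
  proof (rule hardy_funI)
    fix z :: complex assume "z \<notin> ball 0 1"
    hence "F z = 0" by (rule A(3))
    thus "(\<chi> i. F z $ f i) = 0" by (simp add: vec_eq_iff)
  qed
qed

text \<open>Scalar functions are functions with values in \<open>complex ^ 1\<close>.\<close>

definition hcomponent :: "'n::finite \<Rightarrow> 'n hardy \<Rightarrow> 1 hardy" where
  "hcomponent i = hcomp (\<lambda>_. i)"

section \<open>Near invariance with defect\<close>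

definition defect_space :: "'n::finite hardy set \<Rightarrow> 'n hardy set \<Rightarrow> nat \<Rightarrow> bool" where
  "defect_space M D p \<longleftrightarrow>
     (\<exists>B. finite B \<and> hardy.span B = D) \<and> hardy.dim D = p \<and> horthogonal M D \<and>
     (\<forall>F\<in>M. hval F 0 = 0 \<longrightarrow> hbshift F \<in> {G + H | G H. G \<in> M \<and> H \<in> D})"

definition nearly_invariant_defect :: "'n::finite hardy set \<Rightarrow> nat \<Rightarrow> bool" where
  "nearly_invariant_defect M p \<longleftrightarrow>
     hardy.subspace M \<and> closed M \<and> (\<exists>D. defect_space M D p)"

definition columns_matrix :: "('r::finite \<Rightarrow> 'm::finite hardy) \<Rightarrow> complex \<Rightarrow> complex ^ 'r ^ 'm" where
  "columns_matrix W z = (\<chi> i l. hval (W l) z $ i)"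

definition closed_bshift_invariant :: "'n::finite hardy set \<Rightarrow> bool" where
  "closed_bshift_invariant K \<longleftrightarrow> hardy.subspace K \<and> closed K \<and> hbshift ` K \<subseteq> K"

text \<open>The space of \<open>complex ^ ('r + 'p)\<close>-valued functions is the product of the space of
  \<open>complex ^ 'r\<close>-valued ones and \<open>CARD('p)\<close> scalar ones: a tuple \<open>(K\<^sub>0, k\<^sub>1, \<dots>, k\<^sub>p)\<close> is an element \<open>K\<close>
  with \<open>K\<^sub>0 = hcomp Inl K\<close> and \<open>k\<^sub>j = hcomponent (Inr j) K\<close>.  The two functions below need not lie in
  the Hardy space; they vanish off the disc because \<open>W\<close>, \<open>E\<close> and \<open>K\<close> do.\<close>

definition rep_nonvanishing ::
  "('r::finite \<Rightarrow> 'm::finite hardy) \<Rightarrow> ('p::finite \<Rightarrow> 'm hardy) \<Rightarrow> ('r + 'p) hardy \<Rightarrow>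
    complex \<Rightarrow> complex ^ 'm" where
  "rep_nonvanishing W E K z =
     columns_matrix W z *v hval (hcomp Inl K) z +
     (\<Sum>j\<in>UNIV. (z * hval (hcomponent (Inr j) K) z $ 1) *s hval (E j) z)"

definition rep_vanishing ::
  "('p::finite \<Rightarrow> 'm::finite hardy) \<Rightarrow> 'p hardy \<Rightarrow> complex \<Rightarrow> complex ^ 'm" where
  "rep_vanishing E K z =
     (\<Sum>j\<in>UNIV. (z * hval (hcomponent j K) z $ 1) *s hval (E j) z)"

end

theory Submission
  imports Defs
begin

text \<open>For \<open>F\<close> in \<open>M\<close>, subtracting the projection onto \<open>W\<close> leaves a function vanishing at \<open>0\<close>; its
  backward shift lies in \<open>M \<oplus> D\<close>.  Let \<open>T F\<close> be the component in \<open>M\<close> and \<open>c F\<close> the vector of the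
  coefficients along \<open>W\<close> and \<open>E\<close>.  Then \<open>\<parallel>F\<parallel>\<^sup>2 = \<parallel>c F\<parallel>\<^sup>2 + \<parallel>T F\<parallel>\<^sup>2\<close>, and iterating this gives the model
  map \<open>V F = (\<Sum>n. z\<^sup>n c (T\<^sup>n F))\<close>, which intertwines \<open>T\<close> with the backward shift and is isometric as
  soon as \<open>T\<^sup>n\<close> tends to \<open>0\<close> strongly; then \<open>K = V ` M\<close>.

  Strong stability reduces to that of \<open>B = S\<^sup>* (1 - R)\<close> with \<open>R\<close> a finite rank orthogonal projection with
  orthonormal basis \<open>e\<close>.  The coefficients \<open>\<langle>B\<^sup>n x, e\<^sub>i\<rangle>\<close> solve a lower triangular block Toeplitz system
  with matrix \<open>L\<close> and right-hand side \<open>\<langle>S\<^sup>*\<^sup>n x, e\<^sub>i\<rangle>\<close>, where \<open>L + L\<^sup>*\<close> is \<open>1\<close> plus a Gram matrix.  So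
  \<open>L\<close> has an inverse of norm at most \<open>2\<close>, and when the right-hand side has finite support,
  convolution with the coefficients is bounded on square summable sequences.  This makes the Cesaro
  means of \<open>\<parallel>B\<^sup>n x\<parallel>\<^sup>2\<close> tend to \<open>0\<close> for a dense set of \<open>x\<close>.\<close>

section \<open>Strong stability of a finite rank perturbation of the backward shift\<close>

text \<open>Gram--Schmidt in \<open>y\<close>, one vector at a time, splits off a rank one Gram matrix.\<close>

lemma Schur_product_nonneg:
  fixes x :: "'k \<Rightarrow> 'a::real_inner" and y :: "'k \<Rightarrow> 'b::real_inner"
  assumes "finite P"
  shows "0 \<le> (\<Sum>p\<in>P. \<Sum>q\<in>P. inner (x p) (x q) * inner (y p) (y q))"
  using assms
proof (induction P arbitrary: y rule: finite_induct)
  case (insert r P)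
  define d where "d = inner (y r) (y r)"
  \<comment> \<open>If \<open>y r\<close> is zero, then \<open>d\<close> is zero and the quotient is
    zero by convention; \<open>cd\<close> still holds, since both of its sides vanish.\<close>
  define c where "c p = inner (y p) (y r) / d" for p
  define y' where "y' p = y p - c p *\<^sub>R y r" for p
  have cd: "c p * d = inner (y p) (y r)" for p
    by (simp add: c_def d_def)
  have y'r: "y' r = 0"
    by (cases "y r = 0") (simp_all add: y'_def c_def d_def)
  have y_split: "inner (y p) (y q) = inner (y' p) (y' q) + d * (c p * c q)" for p q
  proof -
    have "inner (y' p) (y' q) = inner (y p) (y q) - c q * inner (y p) (y r) - c p * inner (y q) (y r) + c p * c q * d"
      by (simp add: y'_def inner_diff_left inner_diff_right d_def inner_commute[of "y r" "y q"] right_diff_distrib)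
    thus ?thesis by (simp flip: cd)
  qed
  have "(\<Sum>p\<in>insert r P. \<Sum>q\<in>insert r P. inner (x p) (x q) * inner (y p) (y q))
      = (\<Sum>p\<in>insert r P. \<Sum>q\<in>insert r P. inner (x p) (x q) * inner (y' p) (y' q))
        + d * (\<Sum>p\<in>insert r P. \<Sum>q\<in>insert r P. inner (c p *\<^sub>R x p) (c q *\<^sub>R x q))"
  proof -
    have "inner (x p) (x q) * inner (y p) (y q)
        = inner (x p) (x q) * inner (y' p) (y' q) + d * inner (c p *\<^sub>R x p) (c q *\<^sub>R x q)" for p q
      unfolding y_split[of p q] by (simp add: distrib_left)
    thus ?thesis by (simp only: sum.distrib sum_distrib_left)
  qed
  also have "(\<Sum>p\<in>insert r P. \<Sum>q\<in>insert r P. inner (c p *\<^sub>R x p) (c q *\<^sub>R x q))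
      = (norm (\<Sum>p\<in>insert r P. c p *\<^sub>R x p))\<^sup>2"
    by (simp only: power2_norm_eq_inner inner_sum_left inner_sum_right) (rule sum.swap)
  also have "(\<Sum>p\<in>insert r P. \<Sum>q\<in>insert r P. inner (x p) (x q) * inner (y' p) (y' q))
      = (\<Sum>p\<in>P. \<Sum>q\<in>P. inner (x p) (x q) * inner (y' p) (y' q))"
    using insert.hyps by (simp add: y'r)
  finally show ?case
    using insert.IH[of y'] by (simp add: d_def)
qed simp

text \<open>Both sides sum over all triples of indices with total \<open>n\<close>. The
  associativity is wanted for a vector-valued last factor, so that a scalar Toeplitz matrix can be
  applied to a convolution with \<open>h\<close>.\<close>

lemma convolution_assoc:
  fixes b :: "nat \<Rightarrow> real" and a :: "nat \<Rightarrow> real" and h :: "nat \<Rightarrow> 'a::real_vector"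
  shows "(\<Sum>m\<le>n. b (n - m) *\<^sub>R (\<Sum>k\<le>m. a k *\<^sub>R h (m - k)))
       = (\<Sum>k\<le>n. (\<Sum>m\<le>k. b (k - m) * a m) *\<^sub>R h (n - k))"
proof -
  have "(\<Sum>m\<le>n. b (n - m) *\<^sub>R (\<Sum>k\<le>m. a k *\<^sub>R h (m - k)))
      = (\<Sum>j=0..n. \<Sum>i=0..j. (b (n - j) * a i) *\<^sub>R h (j - i))"
    by (simp add: scaleR_sum_right atMost_atLeast0)
  also have "\<dots> = (\<Sum>j=0..n. \<Sum>i=0..n - j. (b (n - j - i) * a j) *\<^sub>R h i)"
    by (rule fps_mult_assoc_lemma)
  also have "\<dots> = (\<Sum>j=0..n. \<Sum>i=0..n - j. (b i * a j) *\<^sub>R h (n - j - i))"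
  proof (rule sum.cong[OF refl])
    fix j
    show "(\<Sum>i=0..n - j. (b (n - j - i) * a j) *\<^sub>R h i)
        = (\<Sum>i=0..n - j. (b i * a j) *\<^sub>R h (n - j - i))"
      by (rule sum.reindex_bij_witness[of _ "\<lambda>i. n - j - i" "\<lambda>i. n - j - i"]) (auto simp del: diff_diff_left)
  qed
  also have "\<dots> = (\<Sum>j=0..n. \<Sum>i=0..j. (b (j - i) * a i) *\<^sub>R h (n - j))"
    by (rule fps_mult_assoc_lemma[symmetric, where f = "\<lambda>i l m. (b l * a i) *\<^sub>R h m"])
  also have "\<dots> = (\<Sum>k\<le>n. (\<Sum>m\<le>k. b (k - m) * a m) *\<^sub>R h (n - k))"
    by (simp add: scaleR_sum_left atMost_atLeast0)
  finally show ?thesis .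
qed

text \<open>This passes from the quadratic form of a lower triangular matrix to that of its
  symmetrization, where positivity is available.\<close>

lemma sum_triangle_symmetric:
  fixes t :: "nat \<Rightarrow> nat \<Rightarrow> real"
  assumes "\<And>n m. t n m = t m n"
  shows "2 * (\<Sum>n<N. \<Sum>m\<le>n. t n m) = (\<Sum>n<N. \<Sum>m<N. t n m) + (\<Sum>n<N. t n n)"
proof (induction N)
  case (Suc N)
  have "(\<Sum>n<Suc N. \<Sum>m<Suc N. t n m) = (\<Sum>n<N. \<Sum>m<N. t n m) + (\<Sum>n<N. t n N) + (\<Sum>m<N. t N m) + t N N"
    by (simp add: sum.distrib)
  moreover have "(\<Sum>n<N. t n N) = (\<Sum>m<N. t N m)"
    using assms by simp
  moreover have "(\<Sum>m\<le>N. t N m) = (\<Sum>m<N. t N m) + t N N"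
    by (simp add: lessThan_Suc_atMost[symmetric])
  ultimately show ?case using Suc by simp
qed simp

lemma norm_sum_power2_le:
  fixes f :: "'i \<Rightarrow> 'a::real_normed_vector"
  shows "(norm (sum f I))\<^sup>2 \<le> real (card I) * (\<Sum>i\<in>I. (norm (f i))\<^sup>2)"
proof -
  have "(norm (sum f I))\<^sup>2 \<le> (\<Sum>i\<in>I. norm (f i))\<^sup>2"
    by (intro power_mono norm_sum) auto
  also have "\<dots> \<le> (\<Sum>i\<in>I. 1\<^sup>2) * (\<Sum>i\<in>I. (norm (f i))\<^sup>2)"
    using Cauchy_Schwarz_ineq_sum[of "\<lambda>_. 1" "\<lambda>i. norm (f i)" I] by simp
  finally show ?thesis by simp
qed

text \<open>At most \<open>d\<close> terms contribute for each \<open>n\<close>, so Cauchy-Schwarz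
  costs one factor \<open>d\<close>; summing the \<open>d\<close> shifted copies of \<open>h\<close>
  costs the other.\<close>

lemma convolution_finite_support_bound:
  fixes h :: "nat \<Rightarrow> 'a::real_normed_vector"
  assumes "\<And>k. k \<ge> d \<Longrightarrow> a k = 0" "\<And>k. \<bar>a k\<bar> \<le> c"
  shows "(\<Sum>n<N. (norm (\<Sum>k\<le>n. a k *\<^sub>R h (n - k)))\<^sup>2) \<le> (real d * c)\<^sup>2 * (\<Sum>n<N. (norm (h n))\<^sup>2)"
proof -
  have c: "0 \<le> c" using assms(2)[of 0] by linarith
  \<comment> \<open>The shift of \<open>h\<close> by \<open>k\<close>, extended by zero, so that the
    range of \<open>k\<close> no longer depends on \<open>n\<close>.\<close>
  define g where "g n k = (if k \<le> n then norm (h (n - k)) else 0)" for n k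
  have "(norm (\<Sum>k\<le>n. a k *\<^sub>R h (n - k)))\<^sup>2 \<le> real d * c\<^sup>2 * (\<Sum>k<d. (g n k)\<^sup>2)" for n
  proof -
    have "(\<Sum>k\<le>n. a k *\<^sub>R h (n - k)) = (\<Sum>k\<in>{..n} \<inter> {..<d}. a k *\<^sub>R h (n - k))"
      by (rule sum.mono_neutral_right) (auto simp: assms(1) not_less)
    also have "\<dots> = (\<Sum>k<d. if k \<le> n then a k *\<^sub>R h (n - k) else 0)"
      by (subst Int_commute) (simp add: sum.inter_restrict)
    finally have "(norm (\<Sum>k\<le>n. a k *\<^sub>R h (n - k)))\<^sup>2
        \<le> real d * (\<Sum>k<d. (norm (if k \<le> n then a k *\<^sub>R h (n - k) else 0))\<^sup>2)"
      using norm_sum_power2_le[of "\<lambda>k. if k \<le> n then a k *\<^sub>R h (n - k) else 0" "{..<d}"] by simp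
    also have "\<dots> \<le> real d * (\<Sum>k<d. c\<^sup>2 * (g n k)\<^sup>2)"
      by (intro mult_left_mono sum_mono)
         (auto simp: g_def power_mult_distrib abs_le_square_iff[symmetric] c assms(2) intro!: mult_right_mono)
    finally show ?thesis by (simp add: sum_distrib_left mult.assoc)
  qed
  hence "(\<Sum>n<N. (norm (\<Sum>k\<le>n. a k *\<^sub>R h (n - k)))\<^sup>2) \<le> (\<Sum>n<N. real d * c\<^sup>2 * (\<Sum>k<d. (g n k)\<^sup>2))"
    by (intro sum_mono)
  also have "\<dots> = real d * c\<^sup>2 * (\<Sum>k<d. \<Sum>n<N. (g n k)\<^sup>2)"
    by (subst sum.swap) (simp add: sum_distrib_left)
  also have "\<dots> \<le> real d * c\<^sup>2 * (\<Sum>k<d. \<Sum>n<N. (norm (h n))\<^sup>2)"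
  proof (rule mult_left_mono[OF sum_mono])
    fix k
    have "(\<Sum>n<N. (g n k)\<^sup>2) = (\<Sum>n\<in>{k..<N}. (norm (h (n - k)))\<^sup>2)"
      by (rule sum.mono_neutral_cong_right) (auto simp: g_def)
    also have "\<dots> = (\<Sum>n\<in>{..<N - k}. (norm (h n))\<^sup>2)"
      by (rule sum.reindex_bij_witness[of _ "\<lambda>i. i + k" "\<lambda>i. i - k"]) auto
    also have "\<dots> \<le> (\<Sum>n<N. (norm (h n))\<^sup>2)"
      by (rule sum_mono2) auto
    finally show "(\<Sum>n<N. (g n k)\<^sup>2) \<le> (\<Sum>n<N. (norm (h n))\<^sup>2)" .
  qed simp
  finally show ?thesis by (simp add: power_mult_distrib power2_eq_square mult_ac)
qed

text \<open>A limit \<open>l\<close> of the decreasing sequence bounds it from below, so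
  \<open>N * l\<close> is at most \<open>C\<close> times the sum of the first \<open>N\<close>
  values of \<open>q\<close>. That sum is \<open>o(N)\<close>, which forces
  \<open>l = 0\<close>.\<close>

lemma decseq_null_if_Cesaro:
  fixes u q :: "nat \<Rightarrow> real"
  assumes "decseq u" "\<And>n. 0 \<le> u n" "q \<longlonglongrightarrow> 0" "0 \<le> C"
    and le: "\<And>N. (\<Sum>n<N. u n) \<le> C * (\<Sum>n<N. q n)"
  shows "u \<longlonglongrightarrow> 0"
proof -
  obtain l where l: "u \<longlonglongrightarrow> l" "\<And>n. l \<le> u n"
    using decseq_convergent[OF assms(1), of 0] assms(2) by blast
  have l0: "0 \<le> l" using l(1) assms(2) by (intro LIMSEQ_le_const) auto
  have "\<not> 0 < l"
  proof
    assume lp: "0 < l"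
    \<comment> \<open>Beyond \<open>n0\<close> each term of \<open>C * q\<close> is to cost at most
      \<open>l / 2\<close>, half of what \<open>u\<close> contributes; the summand 1 keeps the
      denominator positive when \<open>C = 0\<close>.\<close>
    define d where "d = l / (2 * (C + 1))"
    have d: "0 < d" "C * d \<le> l / 2"
      using lp assms(4) by (auto simp: d_def field_simps)
    obtain n0 where n0: "\<And>n. n \<ge> n0 \<Longrightarrow> \<bar>q n\<bar> < d"
      using LIMSEQ_D[OF assms(3) d(1)] by auto
    define A where "A = (\<Sum>n<n0. \<bar>q n\<bar>)"
    have q: "(\<Sum>n<N. q n) \<le> A + real N * d" for N
    proof -
      have "(\<Sum>n<N. q n) \<le> (\<Sum>n<N. (if n < n0 then \<bar>q n\<bar> else 0) + d)"
      proof (rule sum_mono)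
        fix n show "q n \<le> (if n < n0 then \<bar>q n\<bar> else 0) + d"
          using n0[of n] d(1) by (cases "n < n0") auto
      qed
      also have "\<dots> = (\<Sum>n\<in>{..<N} \<inter> {..<n0}. \<bar>q n\<bar>) + real N * d"
        by (simp add: sum.distrib sum.inter_restrict)
      also have "(\<Sum>n\<in>{..<N} \<inter> {..<n0}. \<bar>q n\<bar>) \<le> A"
        unfolding A_def by (rule sum_mono2) auto
      finally show ?thesis by simp
    qed
    have "real N * l \<le> C * A + real N * (l / 2)" for N
    proof -
      have "real N * l \<le> (\<Sum>n<N. u n)"
        using sum_mono[of "{..<N}" "\<lambda>_. l" u] l(2) by simp
      also have "\<dots> \<le> C * (A + real N * d)"
        by (rule order_trans[OF le mult_left_mono[OF q assms(4)]])
      also have "\<dots> \<le> C * A + real N * (l / 2)"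
        using mult_left_mono[OF d(2), of "real N"] by (simp add: algebra_simps)
      finally show ?thesis .
    qed
    hence *: "real N * (l / 2) \<le> C * A" for N
      by (metis add_le_cancel_right distrib_left field_sum_of_halves)
    obtain N :: nat where "C * A < real N * (l / 2)"
      using reals_Archimedean3[of "l / 2"] lp by auto
    thus False using *[of N] by simp
  qed
  thus ?thesis using l l0 by simp
qed

text \<open>\<open>S\<close> is an isometry with adjoint \<open>S'\<close>, and the powers of
  \<open>S'\<close> tend to 0 strongly. Scalars are real; a complex orthonormal family enters
  through its doubling by the imaginary unit.\<close>

locale perturbed_coisometry =
  fixes S S' :: "'a::real_inner \<Rightarrow> 'a" and e :: "'i::finite \<Rightarrow> 'a"
  assumes lin: "linear S'"
    and adjoint: "\<And>x y. inner (S x) y = inner x (S' y)"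
    and left_inverse: "\<And>x. S' (S x) = x"
    and pure: "\<And>x. (\<lambda>n. (S' ^^ n) x) \<longlonglongrightarrow> 0"
    and orthonormal: "\<And>i j. inner (e i) (e j) = (if i = j then 1 else 0)"
begin

section \<open>The projection, the perturbed operator and their contractivity\<close>

definition R where "R x = (\<Sum>i\<in>UNIV. inner x (e i) *\<^sub>R e i)"

definition B where "B x = S' (x - R x)"

lemma lin_pow: "linear (S' ^^ n)"
  by (induction n) (simp_all only: funpow.simps linear_id linear_compose[OF _ lin])

lemma lin_R: "linear R"
  unfolding R_def
  by (rule linearI)
     (simp_all add: inner_add_left scaleR_add_left sum.distrib scaleR_sum_right)

lemma lin_B: "linear B"
  unfolding B_def
  using linear_compose[OF linear_compose_sub[OF linear_ident lin_R] lin] by (simp add: o_def)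

lemma lin_B_pow: "linear (B ^^ n)"
  by (induction n) (simp_all only: funpow.simps linear_id linear_compose[OF _ lin_B])

lemma adjoint_pow: "inner ((S ^^ n) x) y = inner x ((S' ^^ n) y)"
  by (induction n arbitrary: y) (simp_all add: adjoint funpow_swap1[of S'])

lemma left_inverse_pow: "m \<le> n \<Longrightarrow> (S' ^^ n) ((S ^^ m) x) = (S' ^^ (n - m)) x"
proof (induction m arbitrary: n)
  case (Suc m)
  then obtain n' where n: "n = Suc n'" by (cases n) auto
  thus ?case using Suc by (simp add: funpow_swap1[of S'] left_inverse)
qed simp

lemma norm_pow: "norm ((S ^^ n) x) = norm x"
  by (simp add: norm_eq_sqrt_inner adjoint_pow left_inverse_pow)

lemma inner_R: "inner (R x) (e i) = inner x (e i)"
  by (simp add: R_def inner_sum_left orthonormal if_distrib[of "(*) _"] sum.delta' cong: if_cong)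

lemma norm_contract: "norm (S' x) \<le> norm x"
proof (cases "S' x = 0")
  case False
  have "norm (S' x) * norm (S' x) = inner (S (S' x)) x"
    by (simp add: adjoint power2_norm_eq_inner[symmetric] power2_eq_square)
  also have "\<dots> \<le> norm (S (S' x)) * norm x" by (rule norm_cauchy_schwarz)
  also have "norm (S (S' x)) = norm (S' x)" using norm_pow[of 1] by simp
  finally show ?thesis using False by simp
qed simp

lemma norm_B: "norm (B x) \<le> norm x"
proof -
  have "inner (R x) (x - R x) = 0"
    by (subst (1) R_def) (simp add: inner_sum_left inner_commute[of "e _"] inner_diff_left inner_R)
  hence "(norm x)\<^sup>2 = (norm (x - R x))\<^sup>2 + (norm (R x))\<^sup>2"
    using norm_add_Pythagorean[of "x - R x" "R x"] by (simp add: orthogonal_def inner_commute)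
  hence "(norm (x - R x))\<^sup>2 \<le> (norm x)\<^sup>2" by simp
  hence "norm (x - R x) \<le> norm x" by (rule power2_le_imp_le) simp
  thus ?thesis unfolding B_def by (rule order_trans[OF norm_contract])
qed

text \<open>Variation of constants for \<open>B = S' - S' R\<close>: the term removed at time
  \<open>k\<close> is carried on by the remaining powers of \<open>S'\<close>.\<close>

lemma B_pow_expand: "(B ^^ n) x = (S' ^^ n) x - (\<Sum>k<n. (S' ^^ (n - k)) (R ((B ^^ k) x)))"
proof (induction n)
  case (Suc n)
  have "(B ^^ Suc n) x = S' ((B ^^ n) x) - S' (R ((B ^^ n) x))"
    by (simp add: B_def linear_diff[OF lin])
  also have "S' ((B ^^ n) x) = (S' ^^ Suc n) x - (\<Sum>k<n. (S' ^^ (Suc n - k)) (R ((B ^^ k) x)))"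
    by (subst Suc) (simp add: linear_diff[OF lin] linear_sum[OF lin] Suc_diff_le)
  finally show ?case by simp
qed simp

text \<open>The expansion of \<open>B ^^ n\<close> is tested against \<open>e i\<close>. Including
  \<open>m = n\<close> adds \<open>R ((B ^^ n) x)\<close>, whose coefficients cancel those of
  \<open>(B ^^ n) x\<close>, so that an equation for the coefficients alone remains.\<close>

lemma coefficient_equation:
  "(\<Sum>m\<le>n. \<Sum>j\<in>UNIV. inner ((S' ^^ (n - m)) (e j)) (e i) * inner ((B ^^ m) x) (e j))
    = inner ((S' ^^ n) x) (e i)"
proof -
  have "(\<Sum>m\<le>n. (S' ^^ (n - m)) (R ((B ^^ m) x))) = (S' ^^ n) x - (B ^^ n) x + R ((B ^^ n) x)"
    using B_pow_expand[of n x] by (simp add: lessThan_Suc_atMost[symmetric])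
  hence "inner (\<Sum>m\<le>n. (S' ^^ (n - m)) (R ((B ^^ m) x))) (e i) = inner ((S' ^^ n) x) (e i)"
    by (simp add: inner_diff_left inner_add_left inner_R)
  thus ?thesis
    by (simp add: R_def linear_sum[OF lin_pow] linear_scale[OF lin_pow] inner_sum_left mult.commute)
qed

text \<open>For \<open>m \<le> n\<close> the matrix entry is the inner product of
  \<open>(S ^^ n) (e i)\<close> and \<open>(S ^^ m) (e j)\<close>, since \<open>S\<close> is
  isometric. Twice the quadratic form is thus that of a full Gram matrix plus the diagonal, which is
  the identity by orthonormality. The Schur product bound makes the Gram part nonnegative for
  vector-valued \<open>w\<close> as well.\<close>

lemma Toeplitz_accretive:
  fixes w :: "nat \<Rightarrow> 'i \<Rightarrow> 'b::real_inner"
  shows "(\<Sum>n<N. \<Sum>i\<in>UNIV. (norm (w n i))\<^sup>2)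
    \<le> 2 * (\<Sum>n<N. \<Sum>i\<in>UNIV. inner (w n i) (\<Sum>m\<le>n. \<Sum>j\<in>UNIV. inner ((S' ^^ (n - m)) (e j)) (e i) *\<^sub>R w m j))"
proof -
  define t where "t n m = (\<Sum>i\<in>UNIV. \<Sum>j\<in>UNIV.
      inner ((S ^^ n) (e i)) ((S ^^ m) (e j)) * inner (w n i) (w m j))" for n m
  have sym: "t n m = t m n" for n m
    unfolding t_def by (subst sum.swap) (simp add: inner_commute)
  have diag: "t n n = (\<Sum>i\<in>UNIV. (norm (w n i))\<^sup>2)" for n
    by (simp add: t_def adjoint_pow left_inverse_pow orthonormal power2_norm_eq_inner if_distrib[of "\<lambda>x. x * _"] cong: if_cong)
  have "(\<Sum>i\<in>UNIV. inner (w n i) (\<Sum>m\<le>n. \<Sum>j\<in>UNIV. inner ((S' ^^ (n - m)) (e j)) (e i) *\<^sub>R w m j))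
      = (\<Sum>m\<le>n. t n m)" for n
  proof -
    have "(\<Sum>m\<le>n. t n m) = (\<Sum>i\<in>UNIV. \<Sum>m\<le>n. \<Sum>j\<in>UNIV.
        inner ((S ^^ n) (e i)) ((S ^^ m) (e j)) * inner (w n i) (w m j))"
      unfolding t_def by (rule sum.swap)
    also have "\<dots> = (\<Sum>i\<in>UNIV. \<Sum>m\<le>n. \<Sum>j\<in>UNIV.
        inner ((S' ^^ (n - m)) (e j)) (e i) * inner (w n i) (w m j))"
      by (intro sum.cong refl) (simp add: adjoint_pow left_inverse_pow inner_commute[of "e _"])
    finally show ?thesis by (simp add: inner_sum_right)
  qed
  hence "2 * (\<Sum>n<N. \<Sum>i\<in>UNIV. inner (w n i) (\<Sum>m\<le>n. \<Sum>j\<in>UNIV. inner ((S' ^^ (n - m)) (e j)) (e i) *\<^sub>R w m j))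
      = (\<Sum>n<N. \<Sum>m<N. t n m) + (\<Sum>n<N. \<Sum>i\<in>UNIV. (norm (w n i))\<^sup>2)"
    using sum_triangle_symmetric[where t = t and N = N, OF sym] by (simp add: diag)
  moreover have "0 \<le> (\<Sum>n<N. \<Sum>m<N. t n m)"
  proof -
    have "(\<Sum>n<N. \<Sum>m<N. t n m) = (\<Sum>p\<in>{..<N} \<times> UNIV. \<Sum>q\<in>{..<N} \<times> UNIV.
        inner ((S ^^ fst p) (e (snd p))) ((S ^^ fst q) (e (snd q))) *
        inner (w (fst p) (snd p)) (w (fst q) (snd q)))"
      unfolding t_def
      by (simp only: sum.cartesian_product' fst_conv snd_conv split_conv sum.swap[of _ UNIV "{..<N}"])
    thus ?thesis by (simp only: Schur_product_nonneg finite_cartesian_product finite_lessThan finite)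
  qed
  ultimately show ?thesis by linarith
qed

text \<open>Accretivity bounds the square sum of \<open>w\<close> by twice its pairing with
  \<open>v\<close>; Young's inequality then absorbs half of it into the left-hand side.\<close>

lemma Toeplitz_inverse_bound:
  fixes w :: "nat \<Rightarrow> 'i \<Rightarrow> 'b::real_inner"
  assumes "\<And>n i. (\<Sum>m\<le>n. \<Sum>j\<in>UNIV. inner ((S' ^^ (n - m)) (e j)) (e i) *\<^sub>R w m j) = v n i"
  shows "(\<Sum>n<N. \<Sum>i\<in>UNIV. (norm (w n i))\<^sup>2) \<le> 4 * (\<Sum>n<N. \<Sum>i\<in>UNIV. (norm (v n i))\<^sup>2)"
proof -
  have "(\<Sum>n<N. \<Sum>i\<in>UNIV. (norm (w n i))\<^sup>2) \<le> (\<Sum>n<N. \<Sum>i\<in>UNIV. 2 * inner (w n i) (v n i))"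
    using Toeplitz_accretive[of w N] by (simp add: assms sum_distrib_left)
  also have "\<dots> \<le> (\<Sum>n<N. \<Sum>i\<in>UNIV. (norm (w n i))\<^sup>2 / 2 + 2 * (norm (v n i))\<^sup>2)"
  proof (intro sum_mono)
    fix n i
    have "0 \<le> (norm (w n i - 2 *\<^sub>R v n i))\<^sup>2" by simp
    thus "2 * inner (w n i) (v n i) \<le> (norm (w n i))\<^sup>2 / 2 + 2 * (norm (v n i))\<^sup>2"
      by (simp add: power2_norm_eq_inner inner_diff_left inner_diff_right inner_commute[of "v n i" "w n i"])
  qed
  also have "\<dots> = (\<Sum>n<N. \<Sum>i\<in>UNIV. (norm (w n i))\<^sup>2) / 2 + 2 * (\<Sum>n<N. \<Sum>i\<in>UNIV. (norm (v n i))\<^sup>2)"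
    by (simp only: sum.distrib sum_distrib_left sum_divide_distrib)
  finally show ?thesis by linarith
qed

text \<open>Convolving the coefficient equation with \<open>h\<close> shows that the convolutions on
  the left solve the Toeplitz system whose right-hand side is \<open>h\<close> convolved with the
  coefficients of \<open>(S' ^^ k) x\<close>. These vanish for \<open>k \<ge> d\<close>, so the
  finite support bound applies to the right-hand side.\<close>

lemma multiplier_bound:
  fixes h :: "nat \<Rightarrow> 'b::real_inner"
  assumes "(S' ^^ d) x = 0"
  shows "(\<Sum>n<N. \<Sum>i\<in>UNIV. (norm (\<Sum>k\<le>n. inner ((B ^^ k) x) (e i) *\<^sub>R h (n - k)))\<^sup>2)
    \<le> 4 * real CARD('i) * (real d * norm x)\<^sup>2 * (\<Sum>n<N. (norm (h n))\<^sup>2)"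
proof -
  have ne: "norm (e i) = 1" for i by (simp add: norm_eq_sqrt_inner orthonormal)
  have nS: "norm ((S' ^^ k) x) \<le> norm x" for k
    by (induction k) (simp_all add: order_trans[OF norm_contract])
  have S0: "(S' ^^ k) x = 0" if "k \<ge> d" for k
  proof -
    have "(S' ^^ k) x = (S' ^^ (k - d)) ((S' ^^ d) x)"
      using that by (metis comp_apply funpow_add le_add_diff_inverse2)
    thus ?thesis using assms linear_0[OF lin_pow] by simp
  qed
  have "(\<Sum>m\<le>n. \<Sum>j\<in>UNIV. inner ((S' ^^ (n - m)) (e j)) (e i) *\<^sub>R (\<Sum>k\<le>m. inner ((B ^^ k) x) (e j) *\<^sub>R h (m - k)))
      = (\<Sum>k\<le>n. inner ((S' ^^ k) x) (e i) *\<^sub>R h (n - k))" for n i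
  proof -
    have "(\<Sum>m\<le>n. \<Sum>j\<in>UNIV. inner ((S' ^^ (n - m)) (e j)) (e i) *\<^sub>R (\<Sum>k\<le>m. inner ((B ^^ k) x) (e j) *\<^sub>R h (m - k)))
      = (\<Sum>j\<in>UNIV. \<Sum>m\<le>n. inner ((S' ^^ (n - m)) (e j)) (e i) *\<^sub>R (\<Sum>k\<le>m. inner ((B ^^ k) x) (e j) *\<^sub>R h (m - k)))"
      by (rule sum.swap)
    also have "\<dots> = (\<Sum>j\<in>UNIV. \<Sum>k\<le>n. (\<Sum>m\<le>k. inner ((S' ^^ (k - m)) (e j)) (e i) * inner ((B ^^ m) x) (e j)) *\<^sub>R h (n - k))"
      by (rule sum.cong[OF refl]) (rule convolution_assoc[where b = "\<lambda>m. inner ((S' ^^ m) (e _)) (e i)"])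
    also have "\<dots> = (\<Sum>k\<le>n. (\<Sum>m\<le>k. \<Sum>j\<in>UNIV. inner ((S' ^^ (k - m)) (e j)) (e i) * inner ((B ^^ m) x) (e j)) *\<^sub>R h (n - k))"
      by (subst sum.swap) (simp only: scaleR_sum_left sum.swap[of _ UNIV "{.._}"])
    finally show ?thesis by (simp only: coefficient_equation)
  qed
  from Toeplitz_inverse_bound[OF this]
  have "(\<Sum>n<N. \<Sum>i\<in>UNIV. (norm (\<Sum>k\<le>n. inner ((B ^^ k) x) (e i) *\<^sub>R h (n - k)))\<^sup>2)
      \<le> 4 * (\<Sum>n<N. \<Sum>i\<in>UNIV. (norm (\<Sum>k\<le>n. inner ((S' ^^ k) x) (e i) *\<^sub>R h (n - k)))\<^sup>2)" .
  also have "\<dots> = 4 * (\<Sum>i\<in>UNIV. \<Sum>n<N. (norm (\<Sum>k\<le>n. inner ((S' ^^ k) x) (e i) *\<^sub>R h (n - k)))\<^sup>2)"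
    by (subst sum.swap) (rule refl)
  also have "\<dots> \<le> 4 * (\<Sum>i\<in>(UNIV::'i set). (real d * norm x)\<^sup>2 * (\<Sum>n<N. (norm (h n))\<^sup>2))"
  proof (intro mult_left_mono sum_mono convolution_finite_support_bound)
    show "\<bar>inner ((S' ^^ k) x) (e i)\<bar> \<le> norm x" for k i
      using Cauchy_Schwarz_ineq2[of "(S' ^^ k) x" "e i"] nS[of k] by (simp add: ne)
  qed (simp_all add: S0)
  finally show ?thesis by simp
qed

text \<open>In the expansion of \<open>(B ^^ n) x\<close> the correction along each
  \<open>e l\<close> is a convolution of the coefficients with the orbit of \<open>e l\<close> under
  \<open>S'\<close>. By the multiplier bound, the square sums of \<open>(B ^^ n) x\<close> are
  controlled by those of orbits of \<open>S'\<close>, whose terms tend to 0. The norms of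
  \<open>(B ^^ n) x\<close> decrease, so control of their means is enough.\<close>

lemma B_pow_null_dense:
  assumes "(S' ^^ d) x = 0"
  shows "(\<lambda>n. (B ^^ n) x) \<longlonglongrightarrow> 0"
proof -
  \<comment> \<open>With \<open>h l 0 = 0\<close> the convolution runs over \<open>k < n\<close> only, as in \<open>B_pow_expand\<close>.\<close>
  define h where "h l m = (if m = 0 then 0 else (S' ^^ m) (e l))" for l m
  define w where "w l n = (\<Sum>k\<le>n. inner ((B ^^ k) x) (e l) *\<^sub>R h l (n - k))" for l n
  define c where "c = 4 * real CARD('i) * (real d * norm x)\<^sup>2"
  define q where "q n = (norm ((S' ^^ n) x))\<^sup>2 + (\<Sum>l\<in>UNIV. (norm (h l n))\<^sup>2)" for n
  define C where "C = 2 + 2 * real CARD('i) * c"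
  have c0: "0 \<le> c" by (simp add: c_def)
  have expand: "(B ^^ n) x = (S' ^^ n) x - (\<Sum>l\<in>UNIV. w l n)" for n
  proof -
    have "(\<Sum>l\<in>UNIV. w l n) = (\<Sum>k\<le>n. \<Sum>l\<in>UNIV. inner ((B ^^ k) x) (e l) *\<^sub>R h l (n - k))"
      unfolding w_def by (rule sum.swap)
    also have "\<dots> = (\<Sum>k<n. \<Sum>l\<in>UNIV. inner ((B ^^ k) x) (e l) *\<^sub>R h l (n - k))"
      by (simp add: lessThan_Suc_atMost[symmetric] h_def)
    also have "\<dots> = (\<Sum>k<n. (S' ^^ (n - k)) (R ((B ^^ k) x)))"
      by (intro sum.cong) (auto simp: h_def R_def linear_sum[OF lin_pow] linear_scale[OF lin_pow])
    finally show ?thesis using B_pow_expand[of n x] by simp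
  qed
  have w: "(\<Sum>n<N. (norm (w l n))\<^sup>2) \<le> c * (\<Sum>n<N. (norm (h l n))\<^sup>2)" for l N
  proof -
    have "(\<Sum>n<N. (norm (w l n))\<^sup>2)
        \<le> (\<Sum>n<N. \<Sum>i\<in>UNIV. (norm (\<Sum>k\<le>n. inner ((B ^^ k) x) (e i) *\<^sub>R h l (n - k)))\<^sup>2)"
      unfolding w_def by (intro sum_mono member_le_sum) auto
    also have "\<dots> \<le> c * (\<Sum>n<N. (norm (h l n))\<^sup>2)"
      unfolding c_def by (rule multiplier_bound[OF assms])
    finally show ?thesis .
  qed
  have "(\<lambda>n. (norm ((B ^^ n) x))\<^sup>2) \<longlonglongrightarrow> 0"
  proof (rule decseq_null_if_Cesaro)
    show "decseq (\<lambda>n. (norm ((B ^^ n) x))\<^sup>2)"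
      by (rule decseq_SucI) (simp add: power_mono norm_B)
    show "q \<longlonglongrightarrow> 0"
    proof -
      have "(\<lambda>n. h l n) \<longlonglongrightarrow> 0" for l
        by (rule Lim_transform_eventually[OF pure[of "e l"]])
           (auto simp: h_def eventually_at_top_linorder intro!: exI[of _ 1])
      hence "(\<lambda>n. (norm ((S' ^^ n) x))\<^sup>2 + (\<Sum>l\<in>UNIV. (norm (h l n))\<^sup>2)) \<longlonglongrightarrow> (norm (0::'a))\<^sup>2 + (\<Sum>l\<in>(UNIV::'i set). (norm (0::'a))\<^sup>2)"
        by (intro tendsto_intros pure)
      thus ?thesis by (simp add: q_def[abs_def])
    qed
    fix N
    have "(norm ((B ^^ n) x))\<^sup>2 \<le> 2 * (norm ((S' ^^ n) x))\<^sup>2 + 2 * real CARD('i) * (\<Sum>l\<in>UNIV. (norm (w l n))\<^sup>2)" for n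
    proof -
      have *: "(norm (a - b))\<^sup>2 \<le> 2 * (norm a)\<^sup>2 + 2 * (norm b)\<^sup>2" for a b :: 'a
        using zero_le_power2[of "norm (a + b)"]
        by (simp add: power2_norm_eq_inner inner_diff_left inner_diff_right inner_add_left inner_add_right)
      show ?thesis
        using *[of "(S' ^^ n) x" "\<Sum>l\<in>UNIV. w l n"] norm_sum_power2_le[of "\<lambda>l. w l n" UNIV]
        by (simp add: expand)
    qed
    hence "(\<Sum>n<N. (norm ((B ^^ n) x))\<^sup>2)
        \<le> (\<Sum>n<N. 2 * (norm ((S' ^^ n) x))\<^sup>2 + 2 * real CARD('i) * (\<Sum>l\<in>UNIV. (norm (w l n))\<^sup>2))"
      by (rule sum_mono)
    also have "\<dots> = 2 * (\<Sum>n<N. (norm ((S' ^^ n) x))\<^sup>2) + 2 * real CARD('i) * (\<Sum>l\<in>UNIV. \<Sum>n<N. (norm (w l n))\<^sup>2)"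
      by (subst sum.swap) (simp add: sum.distrib sum_distrib_left)
    also have "\<dots> \<le> 2 * (\<Sum>n<N. (norm ((S' ^^ n) x))\<^sup>2) + 2 * real CARD('i) * (\<Sum>l\<in>UNIV. c * (\<Sum>n<N. (norm (h l n))\<^sup>2))"
      by (intro add_left_mono mult_left_mono sum_mono w) auto
    also have "\<dots> = 2 * (\<Sum>n<N. (norm ((S' ^^ n) x))\<^sup>2) + 2 * real CARD('i) * c * (\<Sum>n<N. \<Sum>l\<in>UNIV. (norm (h l n))\<^sup>2)"
      unfolding sum.swap[of "\<lambda>n l. (norm (h l n))\<^sup>2" UNIV "{..<N}"] by (simp add: sum_distrib_left mult.assoc)
    also have "\<dots> \<le> C * (\<Sum>n<N. (norm ((S' ^^ n) x))\<^sup>2) + C * (\<Sum>n<N. \<Sum>l\<in>UNIV. (norm (h l n))\<^sup>2)"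
      using c0 by (intro add_mono mult_right_mono sum_nonneg) (auto simp: C_def)
    also have "\<dots> = C * (\<Sum>n<N. q n)"
      by (simp add: q_def sum.distrib distrib_left)
    finally show "(\<Sum>n<N. (norm ((B ^^ n) x))\<^sup>2) \<le> C * (\<Sum>n<N. q n)" .
  qed (use c0 in \<open>auto simp: C_def\<close>)
  from tendsto_real_sqrt[OF this] show ?thesis
    by (simp add: tendsto_norm_zero_iff)
qed

theorem B_pow_null: "(\<lambda>n. (B ^^ n) x) \<longlonglongrightarrow> 0"
proof (rule LIMSEQ_I)
  fix r :: real assume r: "0 < r"
  obtain d where d: "norm ((S' ^^ d) x) < r / 2"
    using LIMSEQ_D[OF pure[of x], of "r / 2"] r by auto
  \<comment> \<open>\<open>S'\<close> is a left inverse of \<open>S\<close>, so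
    \<open>(S' ^^ d) y = 0\<close>; as \<open>S\<close> is isometric, \<open>x - y\<close> has the
    small norm of \<open>(S' ^^ d) x\<close>, and powers of \<open>B\<close> do not increase
    it.\<close>
  define y where "y = x - (S ^^ d) ((S' ^^ d) x)"
  have "(S' ^^ d) y = 0"
    by (simp add: y_def linear_diff[OF lin_pow] left_inverse_pow)
  then obtain n0 where n0: "\<And>n. n \<ge> n0 \<Longrightarrow> norm ((B ^^ n) y) < r / 2"
    using LIMSEQ_D[OF B_pow_null_dense, of d y "r / 2"] r by auto
  have nB: "norm ((B ^^ n) u) \<le> norm u" for n u
    by (induction n) (simp_all add: order_trans[OF norm_B])
  have "norm ((B ^^ n) x - 0) < r" if "n \<ge> n0" for n
  proof -
    have "(B ^^ n) x = (B ^^ n) y + (B ^^ n) (x - y)"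
      by (simp flip: linear_add[OF lin_B_pow])
    moreover have "norm ((B ^^ n) (x - y)) < r / 2"
      using nB[of n "x - y"] d by (simp add: y_def norm_pow)
    ultimately show ?thesis
      using n0[OF that] norm_triangle_ineq[of "(B ^^ n) y" "(B ^^ n) (x - y)"] by simp
  qed
  thus "\<exists>n0. \<forall>n\<ge>n0. norm ((B ^^ n) x - 0) < r" by blast
qed

end

section \<open>Hilbert space structure of the Hardy space\<close>

text \<open>A minimizing sequence converges by completeness, and varying its limit along
  \<open>y\<close> gives orthogonality.\<close>

lemma Hilbert_projection:
  fixes N :: "'a::real_inner set"
  assumes "complete N" "subspace N"
  obtains p where "p \<in> N" "\<And>y. y \<in> N \<Longrightarrow> inner (x - p) y = 0"
proof -
  define d where "d = infdist x N"
  have N0: "N \<noteq> {}" using subspace_0[OF assms(2)] by auto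
  have d_le: "d \<le> norm (x - y)" if "y \<in> N" for y
    unfolding d_def using infdist_le[OF that, of x] by (simp add: dist_norm)
  have d0: "0 \<le> d" by (simp add: d_def infdist_nonneg)
  have "\<exists>y\<in>N. norm (x - y) < d + 1 / real (Suc k)" for k
  proof -
    have "(INF a\<in>N. dist x a) < d + 1 / real (Suc k)"
      using N0 by (simp add: d_def infdist_notempty)
    from cInf_lessD[OF _ this] N0 show ?thesis by (auto simp: dist_norm)
  qed
  then obtain q where q: "\<And>k. q k \<in> N" "\<And>k. norm (x - q k) < d + 1 / real (Suc k)"
    by metis
  have lim: "(\<lambda>k. norm (x - q k)) \<longlonglongrightarrow> d"
  proof (rule tendsto_sandwich[where f = "\<lambda>_. d"])
    show "(\<lambda>k. d + 1 / real (Suc k)) \<longlonglongrightarrow> d"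
      using tendsto_add[OF tendsto_const LIMSEQ_inverse_real_of_nat, of d] by (simp add: inverse_eq_divide)
    show "\<forall>\<^sub>F k in sequentially. norm (x - q k) \<le> d + 1 / real (Suc k)"
      by (intro always_eventually allI less_imp_le q(2))
  qed (use q(1) d_le in auto)
  have "Cauchy q"
  proof (rule metric_CauchyI)
    fix r :: real assume r: "0 < r"
    have "(\<lambda>k. (norm (x - q k))\<^sup>2) \<longlonglongrightarrow> d\<^sup>2" by (intro tendsto_power lim)
    from LIMSEQ_D[OF this, of "r\<^sup>2 / 4"] r
    obtain k0 where k0: "\<And>k. k \<ge> k0 \<Longrightarrow> \<bar>(norm (x - q k))\<^sup>2 - d\<^sup>2\<bar> < r\<^sup>2 / 4" by auto
    have "dist (q i) (q j) < r" if "i \<ge> k0" "j \<ge> k0" for i j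
    proof -
      have "(1/2) *\<^sub>R (q i + q j) \<in> N"
        by (intro subspace_scale subspace_add assms q)
      hence "d\<^sup>2 \<le> (norm (x - (1/2) *\<^sub>R (q i + q j)))\<^sup>2"
        using d_le d0 by (intro power_mono) auto
      \<comment> \<open>The parallelogram law for \<open>x - q i\<close> and \<open>x - q j\<close>;
        the midpoint lies in \<open>N\<close>, so its distance from \<open>x\<close> is at least
        \<open>d\<close>.\<close>
      moreover have "(norm (q i - q j))\<^sup>2 = 2 * (norm (x - q i))\<^sup>2 + 2 * (norm (x - q j))\<^sup>2
          - 4 * (norm (x - (1/2) *\<^sub>R (q i + q j)))\<^sup>2"
        by (simp add: power2_norm_eq_inner inner_diff_left inner_diff_right inner_add_left inner_add_right
            inner_commute[of "q i" x] inner_commute[of "q j" x] inner_commute[of "q j" "q i"] algebra_simps)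
      ultimately have "(norm (q i - q j))\<^sup>2 < r\<^sup>2"
        using k0[OF that(1)] k0[OF that(2)] by linarith
      thus ?thesis using r by (simp add: dist_norm power2_less_imp_less)
    qed
    thus "\<exists>k0. \<forall>i\<ge>k0. \<forall>j\<ge>k0. dist (q i) (q j) < r" by blast
  qed
  then obtain p where p: "p \<in> N" "q \<longlonglongrightarrow> p"
    using assms(1) q(1) unfolding complete_def by blast
  have "(\<lambda>k. norm (x - q k)) \<longlonglongrightarrow> norm (x - p)" by (intro tendsto_intros p)
  hence d: "norm (x - p) = d" using lim LIMSEQ_unique by blast
  have "inner (x - p) y = 0" if y: "y \<in> N" for y
  proof (cases "y = 0")
    case False
    \<comment> \<open>The minimizer of the quadratic polynomial in \<open>t\<close> given by the
      squared distance from \<open>x\<close> to \<open>p + t y\<close>.\<close>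
    define t where "t = inner (x - p) y / inner y y"
    have "d\<^sup>2 \<le> (norm (x - (p + t *\<^sub>R y)))\<^sup>2"
      using d0 by (intro power_mono d_le subspace_add subspace_scale assms p y)
    also have "\<dots> = d\<^sup>2 - (inner (x - p) y)\<^sup>2 / inner y y"
    proof -
      have "(norm (x - (p + t *\<^sub>R y)))\<^sup>2 = (norm (x - p))\<^sup>2 - 2 * t * inner (x - p) y + t * t * inner y y"
        unfolding diff_diff_eq[symmetric]
        by (simp add: power2_norm_eq_inner inner_diff_left[of _ "t *\<^sub>R y"] inner_diff_right[of _ _ "t *\<^sub>R y"] inner_commute[of y "x - p"] right_diff_distrib)
      thus ?thesis using False by (simp add: d t_def power2_eq_square)
    qed
    finally have "(inner (x - p) y)\<^sup>2 / inner y y \<le> 0" by simp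
    moreover have "0 < inner y y" using False by simp
    ultimately show ?thesis by (simp add: divide_le_0_iff)
  qed simp
  with p(1) that show thesis by blast
qed

section \<open>Coefficients, point evaluation and completeness\<close>

lemma norm_hardy_sums: "(\<lambda>k. (norm (hcoeff F k))\<^sup>2) sums (norm F)\<^sup>2"
  using summable_sums[OF summable_hcoeff[of F]] suminf_nonneg[OF summable_hcoeff[of F]]
  by (simp add: norm_hardy_def)

lemma norm_hcoeff_le: "norm (hcoeff F k) \<le> norm F"
proof (rule power2_le_imp_le)
  show "(norm (hcoeff F k))\<^sup>2 \<le> (norm F)\<^sup>2"
    using sum_le_suminf[OF summable_hcoeff[of F], of "{k}"] sums_unique[OF norm_hardy_sums[of F]] by simp
qed simp

text \<open>A geometric series bounds point evaluation; the constant is crude, but continuity at a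
  fixed point of the disc is what the limit arguments use.\<close>

lemma norm_hval_le:
  assumes "norm z < 1"
  shows "norm (hval F z) \<le> norm F / (1 - norm z)"
proof -
  have g: "(\<lambda>k. norm z ^ k * norm F) sums (1 / (1 - norm z) * norm F)"
    using assms by (intro sums_mult2 geometric_sums) simp
  have "norm (hval F z) = norm (\<Sum>k. z ^ k *s hcoeff F k)"
    using hval_sums[of z F] assms by (simp add: sums_iff)
  also have "\<dots> \<le> (\<Sum>k. norm z ^ k * norm F)"
    using g by (intro norm_suminf_le)
      (auto simp: sums_iff norm_vector_scalar_mult norm_power intro!: mult_left_mono norm_hcoeff_le)
  finally show ?thesis using g by (simp add: sums_iff)
qed

definition hardy_of :: "(nat \<Rightarrow> complex ^ 'n) \<Rightarrow> 'n::finite hardy" where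
  "hardy_of A = Abs_hardy (\<lambda>z. if z \<in> ball 0 1 then \<Sum>k. z ^ k *s A k else 0)"

lemma hcoeff_hardy_of:
  assumes A: "summable (\<lambda>k. (norm (A k))\<^sup>2)"
  shows "hcoeff (hardy_of A) = A"
proof -
  let ?F = "\<lambda>z. if z \<in> ball 0 1 then \<Sum>k. z ^ k *s A k else 0"
  \<comment> \<open>Square summable coefficients are bounded, so a geometric series dominates the
    power series on the disc.\<close>
  have "Bseq (\<lambda>k. (norm (A k))\<^sup>2)"
    using convergentI[OF summable_LIMSEQ_zero[OF A]] by (rule convergent_imp_Bseq)
  then obtain C where C: "\<And>k. norm ((norm (A k))\<^sup>2) \<le> C"
    unfolding Bseq_def by blast
  have C': "norm (A k) \<le> 1 + C" for k
  proof -
    have "2 * norm (A k) \<le> (norm (A k))\<^sup>2 + 1" using sum_squares_bound[of "norm (A k)" 1] by simp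
    moreover have "(norm (A k))\<^sup>2 \<le> C" using C[of k] by simp
    ultimately show ?thesis using zero_le_power2[of "norm (A k)"] by linarith
  qed
  have t: "has_taylor ?F A"
    unfolding has_taylor_def
  proof
    fix z :: complex assume z: "z \<in> ball 0 1"
    have "summable (\<lambda>k. z ^ k *s A k)"
    proof (rule summable_comparison_test)
      show "summable (\<lambda>k. norm z ^ k * (1 + C))"
        using z by (intro summable_mult2 summable_geometric) simp
      show "\<exists>N. \<forall>k\<ge>N. norm (z ^ k *s A k) \<le> norm z ^ k * (1 + C)"
        by (auto simp: norm_vector_scalar_mult norm_power intro!: mult_left_mono C')
    qed
    thus "(\<lambda>k. z ^ k *s A k) sums ?F z" using z by (simp add: summable_sums)
  qed
  have "hval (hardy_of A) = ?F"
    unfolding hardy_of_def by (rule Abs_hardy_inverse) (use hardy_funI[OF t A] in simp)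
  thus ?thesis using hcoeff_eqI[of "hardy_of A" A] t by simp
qed

lemma hcoeff_uminus: "hcoeff (- F) = (\<lambda>k. - hcoeff F k)"
  using hcoeff_scaleR[of "- 1" F] by simp

lemma hcoeff_diff: "hcoeff (F - G) = (\<lambda>k. hcoeff F k - hcoeff G k)"
  using hcoeff_add[of F "- G"] by (simp add: hcoeff_uminus)

instance hardy :: (finite) complete_space
proof
  fix X :: "nat \<Rightarrow> 'a hardy" assume X: "Cauchy X"
  have "Cauchy (\<lambda>n. hcoeff (X n) k)" for k
  proof (rule metric_CauchyI)
    fix r :: real assume "0 < r"
    then obtain n0 where n0: "\<And>i j. i \<ge> n0 \<Longrightarrow> j \<ge> n0 \<Longrightarrow> dist (X i) (X j) < r"
      using metric_CauchyD[OF X] by blast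
    have "dist (hcoeff (X i) k) (hcoeff (X j) k) \<le> dist (X i) (X j)" for i j
      using norm_hcoeff_le[of "X i - X j" k] by (simp add: dist_norm hcoeff_diff)
    with n0 show "\<exists>n0. \<forall>i\<ge>n0. \<forall>j\<ge>n0. dist (hcoeff (X i) k) (hcoeff (X j) k) < r"
      by (meson le_less_trans)
  qed
  hence "\<exists>A. \<forall>k. (\<lambda>n. hcoeff (X n) k) \<longlonglongrightarrow> A k"
    by (intro choice allI) (simp add: Cauchy_convergent_iff convergent_def)
  then obtain A where A: "\<And>k. (\<lambda>n. hcoeff (X n) k) \<longlonglongrightarrow> A k" by blast
  \<comment> \<open>The limit in \<open>j\<close> is taken for finitely many coefficients at a time;
    the bound does not depend on \<open>N\<close> and therefore survives \<open>N\<close> tending to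
    infinity.\<close>
  have partial: "(\<Sum>k<N. (norm (hcoeff (X i) k - A k))\<^sup>2) \<le> r\<^sup>2"
    if n0: "\<And>j. j \<ge> n0 \<Longrightarrow> dist (X i) (X j) < r" for i n0 N r
  proof (rule tendsto_upperbound)
    show "(\<lambda>j. \<Sum>k<N. (norm (hcoeff (X i) k - hcoeff (X j) k))\<^sup>2) \<longlonglongrightarrow> (\<Sum>k<N. (norm (hcoeff (X i) k - A k))\<^sup>2)"
      by (intro tendsto_intros A)
    have "(\<Sum>k<N. (norm (hcoeff (X i) k - hcoeff (X j) k))\<^sup>2) \<le> r\<^sup>2" if "j \<ge> n0" for j
    proof -
      have "(\<Sum>k<N. (norm (hcoeff (X i - X j) k))\<^sup>2) \<le> (norm (X i - X j))\<^sup>2"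
        using sum_le_suminf[OF summable_hcoeff[of "X i - X j"], of "{..<N}"]
          sums_unique[OF norm_hardy_sums[of "X i - X j"]] by simp
      also have "\<dots> \<le> r\<^sup>2"
        using n0[OF that] by (intro power_mono) (simp_all add: dist_norm less_imp_le)
      finally show ?thesis by (simp add: hcoeff_diff)
    qed
    thus "\<forall>\<^sub>F j in sequentially. (\<Sum>k<N. (norm (hcoeff (X i) k - hcoeff (X j) k))\<^sup>2) \<le> r\<^sup>2"
      by (auto simp: eventually_at_top_linorder)
  qed simp
  have summ: "summable (\<lambda>k. (norm (hcoeff (X i) k - A k))\<^sup>2)"
    if n0: "\<And>j. j \<ge> n0 \<Longrightarrow> dist (X i) (X j) < r" for i n0 r
  proof (rule bounded_imp_summable[of _ "r\<^sup>2"])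
    show "(\<Sum>k\<le>N. (norm (hcoeff (X i) k - A k))\<^sup>2) \<le> r\<^sup>2" for N
      unfolding lessThan_Suc_atMost[symmetric] by (rule partial[OF n0])
  qed simp
  obtain n1 where n1: "\<And>i j. i \<ge> n1 \<Longrightarrow> j \<ge> n1 \<Longrightarrow> dist (X i) (X j) < 1"
    using metric_CauchyD[OF X zero_less_one] by blast
  have sA: "summable (\<lambda>k. (norm (A k))\<^sup>2)"
  proof -
    have "summable (\<lambda>k. (norm (- (hcoeff (X n1) k - A k) + hcoeff (X n1) k))\<^sup>2)"
      using summ[OF n1[of n1]] by (intro summable_norm_add summable_hcoeff) (simp_all only: norm_minus_cancel order_refl)
    thus ?thesis by simp
  qed
  have "X \<longlonglongrightarrow> hardy_of A"
  proof (rule metric_LIMSEQ_I)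
    fix r :: real assume r: "0 < r"
    obtain n0 where n0: "\<And>i j. i \<ge> n0 \<Longrightarrow> j \<ge> n0 \<Longrightarrow> dist (X i) (X j) < r / 2"
      using metric_CauchyD[OF X, of "r / 2"] r by (meson half_gt_zero)
    have "dist (X i) (hardy_of A) < r" if "i \<ge> n0" for i
    proof -
      have "(\<Sum>k. (norm (hcoeff (X i) k - A k))\<^sup>2) \<le> (r / 2)\<^sup>2"
        using partial[OF n0[OF that]] by (intro suminf_le_const summ[OF n0[OF that]]) auto
      moreover have "(dist (X i) (hardy_of A))\<^sup>2 = (\<Sum>k. (norm (hcoeff (X i) k - A k))\<^sup>2)"
        using sums_unique[OF norm_hardy_sums[of "X i - hardy_of A"]]
        by (simp add: dist_norm hcoeff_diff hcoeff_hardy_of[OF sA])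
      ultimately have "dist (X i) (hardy_of A) \<le> r / 2"
        using r by - (rule power2_le_imp_le, simp_all)
      thus ?thesis using r by simp
    qed
    thus "\<exists>n0. \<forall>i\<ge>n0. dist (X i) (hardy_of A) < r" by blast
  qed
  thus "convergent X" by (rule convergentI)
qed

section \<open>Complex inner product, evaluation and shifts\<close>

lemma hinner_add_left: "hinner (F + G) H = hinner F H + hinner G H"
  unfolding hinner_def suminf_add[OF summable_hinner summable_hinner]
  by (simp add: hcoeff_add distrib_right sum.distrib)

lemma hinner_scale_left: "hinner (hscale c F) H = c * hinner F H"
  unfolding hinner_def suminf_mult[OF summable_hinner, symmetric]
  by (simp add: hcoeff_scale sum_distrib_left mult.assoc)

lemma hinner_commute: "hinner G F = cnj (hinner F G)"
proof -
  have "(\<lambda>k. \<Sum>i\<in>UNIV. hcoeff F k $ i * cnj (hcoeff G k $ i)) sums hinner F G"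
    unfolding hinner_def by (rule summable_sums[OF summable_hinner])
  hence "(\<lambda>k. cnj (\<Sum>i\<in>UNIV. hcoeff F k $ i * cnj (hcoeff G k $ i))) sums cnj (hinner F G)"
    by (simp only: sums_cnj)
  thus ?thesis by (simp add: hinner_def sums_iff mult.commute)
qed

lemma hinner_zero_left [simp]: "hinner 0 H = 0"
  using hinner_scale_left[of 0 0 H] by simp

lemma hinner_diff_left: "hinner (F - G) H = hinner F H - hinner G H"
  using hinner_add_left[of "F - G" G H] by simp

lemma hinner_sum_left: "hinner (sum f I) H = (\<Sum>i\<in>I. hinner (f i) H)"
  by (induction I rule: infinite_finite_induct) (simp_all add: hinner_add_left)

lemma hinner_scale_right: "hinner F (hscale c H) = cnj c * hinner F H"
  by (subst (1 2) hinner_commute) (simp add: hinner_scale_left)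

lemma hinner_self: "hinner F F = of_real ((norm F)\<^sup>2)"
  using inner_eq_Re_hinner[of F F] hinner_commute[of F F]
  by (simp add: complex_eq_iff power2_norm_eq_inner)

text \<open>This upgrades real orthogonality to complex orthogonality whenever the second argument
  ranges over a complex subspace.\<close>

lemma hinner_eq_Complex: "hinner F G = Complex (inner F G) (inner F (hscale \<i> G))"
  by (simp add: complex_eq_iff inner_eq_Re_hinner hinner_scale_right)

lemma hscale_conv_scaleR: "hscale c F = Re c *\<^sub>R F + Im c *\<^sub>R hscale \<i> F"
  by (simp add: scaleR_hardy_def flip: hardy.scale_left_distrib)
     (metis complex_eq mult.commute)

lemma hval_add: "hval (F + G) z = hval F z + hval G z"
  by (simp add: plus_hardy.rep_eq)

lemma hval_zero [simp]: "hval 0 z = 0"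
  by (simp add: zero_hardy.rep_eq)

lemma hval_scale: "hval (hscale c F) z = c *s hval F z"
  by (simp add: hscale.rep_eq)

lemma hval_diff: "hval (F - G) z = hval F z - hval G z"
  using hval_add[of "F - G" G z] by simp

lemma hval_sum: "hval (sum f I) z = (\<Sum>i\<in>I. hval (f i) z)"
  by (induction I rule: infinite_finite_induct) (simp_all add: hval_add)

lemma hval_hshift: "hval (hshift F) z = z *s hval F z"
  by (simp add: hshift.rep_eq)

lemma hbshift_add: "hbshift (F + G) = hbshift F + hbshift G"
  by (rule hardy_eqI) (simp add: hcoeff_hbshift hcoeff_add)

lemma hbshift_scale: "hbshift (hscale c F) = hscale c (hbshift F)"
  by (rule hardy_eqI) (simp add: hcoeff_hbshift hcoeff_scale)

lemma hbshift_hshift: "hbshift (hshift F) = F"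
  by (rule hardy_eqI) (simp add: hcoeff_hbshift hcoeff_hshift)

lemma hshift_hbshift: "hval F 0 = 0 \<Longrightarrow> hshift (hbshift F) = F"
  by (rule hardy_eqI) (simp add: hcoeff_hbshift hcoeff_hshift hcoeff_0)

lemma range_hshift: "range hshift = {F. hval F 0 = 0}"
  by (auto simp: hval_hshift) (metis hshift_hbshift rangeI)

lemma norm_hbshift: "hval F 0 = 0 \<Longrightarrow> norm (hbshift F) = norm F"
  using inner_eq_Re_hinner[of F F] inner_eq_Re_hinner[of "hbshift F" "hbshift F"]
    hinner_hshift[of "hbshift F" F]
  by (simp add: hshift_hbshift norm_eq_sqrt_inner)

lemma hval_hbshift: "hval F z = hval F 0 + z *s hval (hbshift F) z" if "z \<in> ball 0 1"
proof -
  have "(\<lambda>k. z *s (z ^ k *s hcoeff (hbshift F) k)) sums (z *s hval (hbshift F) z)"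
    unfolding sums_vec_iff
    using sums_mult[OF sums_vec_nth[OF hval_sums[OF that, of "hbshift F"]], of z] by (simp add: mult.assoc)
  hence "(\<lambda>k. z ^ Suc k *s hcoeff F (Suc k)) sums (z *s hval (hbshift F) z)"
    by (simp add: hcoeff_hbshift vector_smult_assoc)
  hence "(\<lambda>k. z ^ k *s hcoeff F k) sums (z *s hval (hbshift F) z + hval F 0)"
    by (subst (asm) sums_Suc_iff) (simp add: hcoeff_0)
  thus ?thesis using hval_sums[OF that, of F] sums_unique2 by (simp add: add.commute)
qed

lemma hcoeff_hbshift_pow: "hcoeff ((hbshift ^^ n) F) k = hcoeff F (k + n)"
  by (induction n arbitrary: k) (simp_all add: hcoeff_hbshift)

text \<open>The squared norm of the \<open>n\<close>-th backward shift is the tail of the convergent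
  series for the squared norm of \<open>F\<close>.\<close>

lemma hbshift_pow_null: "(\<lambda>n. (hbshift ^^ n) F) \<longlonglongrightarrow> 0"
proof -
  have "(\<lambda>n. \<Sum>k. (norm (hcoeff F (k + n)))\<^sup>2) \<longlonglongrightarrow> 0"
    by (rule suminf_exist_split2[OF summable_hcoeff])
  moreover have "(\<Sum>k. (norm (hcoeff F (k + n)))\<^sup>2) = (norm ((hbshift ^^ n) F))\<^sup>2" for n
    using sums_unique[OF norm_hardy_sums[of "(hbshift ^^ n) F"]] by (simp add: hcoeff_hbshift_pow)
  ultimately have "(\<lambda>n. sqrt ((norm ((hbshift ^^ n) F))\<^sup>2)) \<longlonglongrightarrow> sqrt 0"
    by (intro tendsto_real_sqrt) simp
  thus ?thesis by (simp add: tendsto_norm_zero_iff)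
qed

lemma subspace_if_complex_subspace: "hardy.subspace M \<Longrightarrow> subspace M"
  unfolding hardy.subspace_def subspace_def by (simp add: scaleR_hardy_def)

section \<open>The isometric model\<close>

text \<open>For an orthonormal \<open>G\<close>, the orthogonal projection onto the span of the
  members with index in \<open>I\<close>. The index set is a parameter because the columns of
  \<open>F_0\<close> and the defect basis are projected onto at different stages.\<close>

definition hproj :: "('q \<Rightarrow> 'm::finite hardy) \<Rightarrow> 'q set \<Rightarrow> 'm hardy \<Rightarrow> 'm hardy" where
  "hproj G I F = (\<Sum>j\<in>I. hscale (hinner F (G j)) (G j))"

lemma hproj_add: "hproj G I (F + F') = hproj G I F + hproj G I F'"
  by (simp add: hproj_def hinner_add_left hardy.scale_left_distrib sum.distrib)

lemma hproj_scale: "hproj G I (hscale c F) = hscale c (hproj G I F)"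
  by (simp add: hproj_def hinner_scale_left hardy.scale_sum_right)

lemma hproj_diff: "hproj G I (F - F') = hproj G I F - hproj G I F'"
  using hproj_add[of G I "F - F'" F'] by simp

lemma hproj_eq_0: "(\<And>j. j \<in> I \<Longrightarrow> hinner F (G j) = 0) \<Longrightarrow> hproj G I F = 0"
  by (simp add: hproj_def)

lemma hproj_mem:
  assumes "hardy.subspace M" "\<And>j. j \<in> I \<Longrightarrow> G j \<in> M"
  shows "hproj G I F \<in> M"
  unfolding hproj_def using assms by (intro hardy.subspace_sum hardy.subspace_scale)

locale orthonormal_family =
  fixes G :: "'q::finite \<Rightarrow> 'm::finite hardy"
  assumes orthonormal: "hinner (G i) (G j) = (if i = j then 1 else 0)"
begin

lemma hinner_hproj: "hinner (hproj G I F) (G j) = (if j \<in> I then hinner F (G j) else 0)"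
  by (simp add: hproj_def hinner_sum_left hinner_scale_left orthonormal if_distrib[of "(*) _"] cong: if_cong)

lemma inner_hproj_residual: "inner (hproj G I F) (F - hproj G I F) = 0"
proof -
  define D where "D = F - hproj G I F"
  have "hinner (G j) D = 0" if "j \<in> I" for j
    by (subst hinner_commute) (simp add: D_def hinner_diff_left hinner_hproj that)
  hence "hinner (hproj G I F) D = 0"
    by (simp add: hproj_def hinner_sum_left hinner_scale_left)
  thus ?thesis by (simp add: inner_eq_Re_hinner D_def)
qed

lemma norm_hproj: "(norm (hproj G I F))\<^sup>2 = (\<Sum>j\<in>I. (cmod (hinner F (G j)))\<^sup>2)"
proof -
  have "complex_of_real ((norm (hproj G I F))\<^sup>2) = (\<Sum>j\<in>I. hinner F (G j) * hinner (G j) (hproj G I F))"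
    unfolding hinner_self[symmetric] by (subst (1) hproj_def) (simp add: hinner_sum_left hinner_scale_left)
  also have "\<dots> = (\<Sum>j\<in>I. complex_of_real ((cmod (hinner F (G j)))\<^sup>2))"
    by (intro sum.cong refl) (simp add: hinner_commute[of "G _"] hinner_hproj complex_norm_square del: of_real_power)
  finally show ?thesis by (simp only: of_real_sum[symmetric] of_real_eq_iff)
qed

lemma norm_Pythagoras: "(norm F)\<^sup>2 = (norm (hproj G I F))\<^sup>2 + (norm (F - hproj G I F))\<^sup>2"
  using norm_add_Pythagorean[of "hproj G I F" "F - hproj G I F"] inner_hproj_residual
  by (simp add: orthogonal_def)

lemma hproj_split: "hproj G UNIV F = hproj G (- I) F + hproj G I F"
  unfolding hproj_def using sum.subset_diff[of I UNIV] by (simp add: Compl_eq_Diff_UNIV)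

text \<open>The abstract stability theorem for the Hardy space: the real projection onto the doubled
  family is the complex projection onto \<open>G\<close>.\<close>

lemma bshift_residual_pow_null: "(\<lambda>n. ((\<lambda>X. hbshift (X - hproj G UNIV X)) ^^ n) F) \<longlonglongrightarrow> 0"
proof -
  \<comment> \<open>a real orthonormal basis of the complex span of \<open>G\<close>\<close>
  define e where "e = (\<lambda>(j, b). if b then G j else hscale \<i> (G j))"
  interpret perturbed_coisometry hshift hbshift e
  proof
    show "hbshift (F + F') = hbshift F + hbshift F'" for F F' :: "'m hardy" by (rule hbshift_add)
    show "hbshift (r *\<^sub>R F) = r *\<^sub>R hbshift F" for r and F :: "'m hardy"
      by (simp add: scaleR_hardy_def hbshift_scale)
    show "inner (e i) (e j) = (if i = j then 1 else 0)" for i j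
      by (cases i; cases j)
         (simp add: e_def inner_eq_Re_hinner hinner_scale_left hinner_scale_right orthonormal)
  qed (simp_all add: inner_eq_Re_hinner hinner_hshift hbshift_hshift hbshift_pow_null)
  have "R X = hproj G UNIV X" for X
  proof -
    have "R X = (\<Sum>j\<in>UNIV. \<Sum>b\<in>UNIV. inner X (e (j, b)) *\<^sub>R e (j, b))"
      unfolding R_def by (simp add: sum.cartesian_product flip: UNIV_Times_UNIV)
    also have "\<dots> = hproj G UNIV X"
      unfolding hproj_def
    proof (rule sum.cong[OF refl])
      fix j
      show "(\<Sum>b\<in>UNIV. inner X (e (j, b)) *\<^sub>R e (j, b)) = hscale (hinner X (G j)) (G j)"
        unfolding hscale_conv_scaleR[of "hinner X (G j)"]
        by (simp add: UNIV_bool e_def hinner_eq_Complex)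
    qed
    finally show ?thesis .
  qed
  hence "B = (\<lambda>X. hbshift (X - hproj G UNIV X))"
    by (simp add: fun_eq_iff B_def)
  thus ?thesis using B_pow_null[of F] by simp
qed

end

text \<open>The common pointwise form of both representations, with the extra factor
  \<open>z\<close> on the indices in \<open>J\<close>. It acts on values, since for an arbitrary
  Hardy function the resulting products need not lie in the Hardy space.\<close>

definition fiber :: "('q \<Rightarrow> 'm::finite hardy) \<Rightarrow> 'q set \<Rightarrow> complex \<Rightarrow> complex ^ 'q \<Rightarrow> complex ^ 'm" where
  "fiber G J z v = (\<Sum>j\<in>UNIV. ((if j \<in> J then z else 1) * v $ j) *s hval (G j) z)"

lemma fiber_add: "fiber G J z (v + w) = fiber G J z v + fiber G J z w"
  by (simp add: fiber_def distrib_left vector_sadd_rdistrib sum.distrib)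

lemma fiber_scale: "fiber G J z (c *s v) = c *s fiber G J z v"
  by (simp add: fiber_def vec.scale_sum_right vector_smult_assoc mult_ac)

lemma fiber_bounded: "\<exists>C. \<forall>v. norm (fiber (G :: 'q::finite \<Rightarrow> 'm::finite hardy) J z v) \<le> C * norm v"
proof (intro exI allI)
  fix v :: "complex ^ 'q"
  have "norm (fiber G J z v) \<le> (\<Sum>j\<in>UNIV. cmod ((if j \<in> J then z else 1) * v $ j) * norm (hval (G j) z))"
    unfolding fiber_def by (rule sum_norm_le) (simp add: norm_vector_scalar_mult)
  also have "\<dots> \<le> (\<Sum>j\<in>UNIV. (cmod z + 1) * norm v * norm (hval (G j) z))"
    unfolding norm_mult
    by (intro sum_mono mult_right_mono mult_mono Finite_Cartesian_Product.norm_nth_le) auto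
  finally show "norm (fiber G J z v) \<le> (\<Sum>j\<in>UNIV. (cmod z + 1) * norm (hval (G j) z)) * norm v"
    by (simp add: sum_distrib_left sum_distrib_right mult_ac)
qed

text \<open>Both cases of the theorem at once: the \<open>G j\<close> with \<open>j \<in> J\<close> span the defect space, the others
  are the columns of \<open>F\<^sub>0\<close>.\<close>

locale near_invariance = orthonormal_family G
  for G :: "'q::finite \<Rightarrow> 'm::finite hardy" +
  fixes M :: "'m hardy set" and J :: "'q set"
  assumes sub: "hardy.subspace M" and closed: "closed M"
    and orth: "\<And>F j. F \<in> M \<Longrightarrow> j \<in> J \<Longrightarrow> hinner F (G j) = 0"
    and mem: "\<And>j. j \<notin> J \<Longrightarrow> G j \<in> M"
    and vanish: "\<And>F. F \<in> M \<Longrightarrow> (\<And>j. j \<notin> J \<Longrightarrow> hinner F (G j) = 0) \<Longrightarrow> hval F 0 = 0"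
    and near: "\<And>F. F \<in> M \<Longrightarrow> hval F 0 = 0 \<Longrightarrow> hbshift F - hproj G J (hbshift F) \<in> M"
begin

section \<open>The operators of the model and their algebra\<close>

definition Y where "Y F = hbshift (F - hproj G (- J) F)"

definition T where "T F = Y F - hproj G J (Y F)"

text \<open>Entries in \<open>J\<close> are read off after the backward shift, which is why
  \<open>fiber\<close> gives them a factor \<open>z\<close>.\<close>

definition c :: "'m hardy \<Rightarrow> complex ^ 'q" where
  "c F = (\<chi> j. if j \<in> J then hinner (Y F) (G j) else hinner F (G j))"

definition V where "V F = hardy_of (\<lambda>n. c ((T ^^ n) F))"

lemma Y_add: "Y (F + F') = Y F + Y F'"
  by (simp add: Y_def hproj_add add_diff_add hbshift_add)

lemma Y_scale: "Y (hscale a F) = hscale a (Y F)"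
  by (simp add: Y_def hproj_scale hbshift_scale flip: hardy.scale_right_diff_distrib)

lemma T_add: "T (F + F') = T F + T F'"
  by (simp add: T_def Y_add hproj_add add_diff_add)

lemma T_scale: "T (hscale a F) = hscale a (T F)"
  by (simp add: T_def Y_scale hproj_scale hardy.scale_right_diff_distrib)

lemma T_pow_add: "(T ^^ n) (F + F') = (T ^^ n) F + (T ^^ n) F'"
  by (induction n) (simp_all add: T_add)

lemma T_pow_scale: "(T ^^ n) (hscale a F) = hscale a ((T ^^ n) F)"
  by (induction n) (simp_all add: T_scale)

lemma c_add: "c (F + F') = c F + c F'"
  by (simp add: vec_eq_iff c_def Y_add hinner_add_left)

lemma c_scale: "c (hscale a F) = a *s c F"
  by (simp add: vec_eq_iff c_def Y_scale hinner_scale_left)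

lemma residual:
  assumes "F \<in> M"
  shows "F - hproj G (- J) F \<in> M" "hval (F - hproj G (- J) F) 0 = 0"
proof -
  show M: "F - hproj G (- J) F \<in> M"
    using assms by (intro hardy.subspace_diff[OF sub] hproj_mem[OF sub] mem) auto
  show "hval (F - hproj G (- J) F) 0 = 0"
    by (rule vanish[OF M]) (simp add: hinner_diff_left hinner_hproj)
qed

lemma T_mem: "F \<in> M \<Longrightarrow> T F \<in> M"
  unfolding T_def Y_def by (intro near residual)

lemma T_pow_mem: "F \<in> M \<Longrightarrow> (T ^^ n) F \<in> M"
  by (induction n) (simp_all add: T_mem)

text \<open>Pythagoras is applied twice, to \<open>F\<close> and to \<open>Y F\<close>; the backward
  shift in between preserves the norm, because the residual vanishes at 0.\<close>

lemma norm_step: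
  assumes "F \<in> M"
  shows "(norm F)\<^sup>2 = (norm (c F))\<^sup>2 + (norm (T F))\<^sup>2"
proof -
  have "(norm (c F))\<^sup>2 = (\<Sum>j\<in>UNIV. (cmod (c F $ j))\<^sup>2)"
    by (simp add: norm_vec_def L2_set_def sum_nonneg)
  also have "\<dots> = (\<Sum>j\<in>- J. (cmod (hinner F (G j)))\<^sup>2) + (\<Sum>j\<in>J. (cmod (hinner (Y F) (G j)))\<^sup>2)"
    by (subst sum.subset_diff[of J UNIV]) (auto simp: c_def Compl_eq_Diff_UNIV)
  finally show ?thesis
    using norm_Pythagoras[of F "- J"] norm_Pythagoras[of "Y F" J] norm_hbshift[OF residual(2)[OF assms]]
    by (simp add: norm_hproj T_def Y_def)
qed

lemma hval_step:
  assumes "F \<in> M"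
  shows "hval F z = fiber G J z (c F) + z *s hval (T F) z"
proof -
  have "F = hproj G (- J) F + hshift (hproj G J (Y F) + T F)"
    using hshift_hbshift[OF residual(2)[OF assms]] by (simp add: T_def Y_def)
  hence "hval F z = hval (hproj G (- J) F) z + z *s hval (hproj G J (Y F)) z + z *s hval (T F) z"
    by (metis hval_add hval_hshift vector_add_ldistrib add.assoc)
  also have "hval (hproj G (- J) F) z = (\<Sum>j\<in>- J. ((if j \<in> J then z else 1) * c F $ j) *s hval (G j) z)"
    by (simp add: hproj_def hval_sum hval_scale c_def)
  also have "z *s hval (hproj G J (Y F)) z = (\<Sum>j\<in>J. ((if j \<in> J then z else 1) * c F $ j) *s hval (G j) z)"
    by (simp add: hproj_def hval_sum hval_scale c_def vec.scale_sum_right vector_smult_assoc)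
  finally show ?thesis
    unfolding fiber_def Compl_eq_Diff_UNIV by (subst sum.subset_diff[of J UNIV]) simp_all
qed

text \<open>Write \<open>B\<close> for the backward shift after removal of the whole span of
  \<open>G\<close>, and \<open>Q\<close> for the removal of the defect part. On \<open>M\<close>,
  which is orthogonal to the defect vectors, \<open>T\<close> is \<open>Q\<close> after
  \<open>B\<close>. Since \<open>B\<close> after \<open>Q\<close> is \<open>B\<close>, powers of
  \<open>T\<close> on \<open>M\<close> reduce to powers of \<open>B\<close> followed by one
  contraction \<open>Q\<close>.\<close>

lemma T_pow_null:
  assumes "F \<in> M"
  shows "(\<lambda>n. (T ^^ n) F) \<longlonglongrightarrow> 0"
proof -
  define B where "B X = hbshift (X - hproj G UNIV X)" for X
  define Q where "Q X = X - hproj G J X" for X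
  have QF: "Q X = X" if "X \<in> M" for X
    unfolding Q_def using hproj_eq_0[of J X G] orth[OF that] by simp
  have T: "T X = Q (B X)" if "X \<in> M" for X
  proof -
    have "hproj G J X = 0" using that by (intro hproj_eq_0 orth)
    thus ?thesis using hproj_split[of X J] by (simp add: T_def Y_def Q_def B_def)
  qed
  have BQ: "B (Q X) = B X" for X
  proof -
    have "hproj G UNIV (hproj G J X) = (\<Sum>j\<in>UNIV. hscale (hinner (hproj G J X) (G j)) (G j))"
      by (rule hproj_def)
    also have "\<dots> = (\<Sum>j\<in>J. hscale (hinner X (G j)) (G j))"
      by (rule sum.mono_neutral_cong_right) (auto simp: hinner_hproj)
    finally have "hproj G UNIV (hproj G J X) = hproj G J X" by (simp add: hproj_def)
    thus ?thesis by (simp add: B_def Q_def hproj_diff)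
  qed
  have pow: "(T ^^ n) F = Q ((B ^^ n) F)" for n
  proof (induction n)
    case (Suc n)
    thus ?case using T[OF T_pow_mem[OF assms, of n]] by (simp add: BQ)
  qed (simp add: QF assms)
  have "norm (Q X) \<le> norm X" for X
  proof (rule power2_le_imp_le)
    show "(norm (Q X))\<^sup>2 \<le> (norm X)\<^sup>2"
      using norm_Pythagoras[of X J] by (simp add: Q_def)
  qed simp
  hence "\<forall>\<^sub>F n in sequentially. norm ((T ^^ n) F) \<le> norm ((B ^^ n) F)"
    by (simp add: pow)
  moreover have "(\<lambda>n. norm ((B ^^ n) F)) \<longlonglongrightarrow> 0"
    using bshift_residual_pow_null[of F] unfolding B_def[abs_def] by (rule tendsto_norm_zero)
  ultimately show ?thesis by (rule Lim_null_comparison)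
qed

text \<open>The norm identities telescope, and strong stability removes the remainder; this is what
  makes \<open>V\<close> isometric.\<close>

lemma c_pow_sums:
  assumes "F \<in> M"
  shows "(\<lambda>n. (norm (c ((T ^^ n) F)))\<^sup>2) sums (norm F)\<^sup>2"
proof -
  have "(\<Sum>n<N. (norm (c ((T ^^ n) F)))\<^sup>2) = (norm F)\<^sup>2 - (norm ((T ^^ N) F))\<^sup>2" for N
  proof (induction N)
    case (Suc N)
    thus ?case using norm_step[OF T_pow_mem[OF assms, of N]] by simp
  qed simp
  moreover have "(\<lambda>N. (norm F)\<^sup>2 - (norm ((T ^^ N) F))\<^sup>2) \<longlonglongrightarrow> (norm F)\<^sup>2 - (norm (0::'m hardy))\<^sup>2"
    by (intro tendsto_intros T_pow_null assms)
  ultimately show ?thesis by (simp add: sums_def)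
qed

lemma hcoeff_V: "F \<in> M \<Longrightarrow> hcoeff (V F) n = c ((T ^^ n) F)"
  unfolding V_def by (subst hcoeff_hardy_of) (use c_pow_sums in \<open>auto simp: sums_iff\<close>)

lemma norm_V: "F \<in> M \<Longrightarrow> norm (V F) = norm F"
  using sums_unique2[OF norm_hardy_sums[of "V F"], of "(norm F)\<^sup>2"] c_pow_sums[of F]
  by (simp add: hcoeff_V power2_eq_iff_nonneg)

lemma V_add: "F \<in> M \<Longrightarrow> F' \<in> M \<Longrightarrow> V (F + F') = V F + V F'"
  by (rule hardy_eqI) (simp add: hcoeff_add hcoeff_V hardy.subspace_add[OF sub] T_pow_add c_add)

lemma V_scale: "F \<in> M \<Longrightarrow> V (hscale a F) = hscale a (V F)"
  by (rule hardy_eqI) (simp add: hcoeff_scale hcoeff_V hardy.subspace_scale[OF sub] T_pow_scale c_scale)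

lemma V_diff: "F \<in> M \<Longrightarrow> F' \<in> M \<Longrightarrow> V (F - F') = V F - V F'"
  using V_add[of "F - F'" F'] hardy.subspace_diff[OF sub] by simp

lemma hbshift_V: "F \<in> M \<Longrightarrow> hbshift (V F) = V (T F)"
  by (rule hardy_eqI) (simp add: hcoeff_hbshift hcoeff_V T_mem funpow_swap1)

text \<open>The difference \<open>D\<close> of the two sides satisfies
  \<open>D X = z D (T X)\<close> on \<open>M\<close> and is bounded in \<open>X\<close>, so
  iterating and letting the powers of \<open>T\<close> tend to 0 gives
  \<open>D F = 0\<close>.\<close>

lemma hval_V:
  assumes "F \<in> M" "z \<in> ball 0 1"
  shows "hval F z = fiber G J z (hval (V F) z)"
proof -
  define D where "D X = hval X z - fiber G J z (hval (V X) z)" for X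
  obtain C where C: "\<And>v. norm (fiber G J z v) \<le> C * norm v" using fiber_bounded by blast
  define b where "b = (1 + \<bar>C\<bar>) / (1 - norm z)"
  have bound: "norm (D X) \<le> b * norm X" if "X \<in> M" for X
  proof -
    have z: "norm z < 1" using assms(2) by simp
    have "norm (D X) \<le> norm (hval X z) + \<bar>C\<bar> * norm (hval (V X) z)"
      unfolding D_def
      by (rule order_trans[OF norm_triangle_ineq4 add_left_mono[OF order_trans[OF C mult_right_mono]]]) auto
    also have "\<dots> \<le> norm X / (1 - norm z) + \<bar>C\<bar> * (norm X / (1 - norm z))"
      using norm_hval_le[OF z, of X] norm_hval_le[OF z, of "V X"]
      by (intro add_mono mult_left_mono) (simp_all add: norm_V that)
    also have "\<dots> = b * norm X"
      by (simp add: b_def add_divide_distrib distrib_right)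
    finally show ?thesis .
  qed
  have step: "D X = z *s D (T X)" if "X \<in> M" for X
  proof -
    have "hval (V X) z = c X + z *s hval (V (T X)) z"
      using hval_hbshift[OF assms(2), of "V X"] hcoeff_V[OF that, of 0]
      by (simp add: hbshift_V that flip: hcoeff_0)
    thus ?thesis
      using hval_step[OF that, of z]
      by (simp add: D_def fiber_add fiber_scale vector_ssub_ldistrib)
  qed
  have "norm (D F) = norm z ^ n * norm (D ((T ^^ n) F))" for n
  proof (induction n)
    case (Suc n)
    thus ?case using step[OF T_pow_mem[OF assms(1), of n]]
      by (simp add: norm_vector_scalar_mult mult_ac)
  qed simp
  moreover have "norm z ^ n * norm (D ((T ^^ n) F)) \<le> 1 * (b * norm ((T ^^ n) F))" for n
    using assms(2) by (intro mult_mono bound T_pow_mem assms(1) power_le_one) auto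
  moreover have "(\<lambda>n. 1 * (b * norm ((T ^^ n) F))) \<longlonglongrightarrow> 1 * (b * norm (0 :: 'm hardy))"
    by (intro tendsto_intros T_pow_null assms(1))
  ultimately have "norm (D F) \<le> 0"
    by (intro LIMSEQ_le_const[of _ 0]) auto
  thus ?thesis by (simp add: D_def)
qed

lemma closed_bshift_invariant_V: "closed_bshift_invariant (V ` M)"
  unfolding closed_bshift_invariant_def
proof (intro conjI)
  show "hardy.subspace (V ` M)"
  proof (rule hardy.subspaceI)
    have "V 0 = 0" using V_scale[OF hardy.subspace_0[OF sub], of 0] by simp
    thus "0 \<in> V ` M" using hardy.subspace_0[OF sub] by (metis imageI)
    show "x + y \<in> V ` M" if "x \<in> V ` M" "y \<in> V ` M" for x y
      using that hardy.subspace_add[OF sub] by (auto simp flip: V_add)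
    show "hscale a x \<in> V ` M" if "x \<in> V ` M" for a x
      using that hardy.subspace_scale[OF sub] by (auto simp flip: V_scale)
  qed
  show "hbshift ` V ` M \<subseteq> V ` M"
    by (auto simp: hbshift_V T_mem)
  show "closed (V ` M)"
  \<comment> \<open>An isometric image of a complete space is complete: preimages of a Cauchy
    sequence are again Cauchy and converge in \<open>M\<close>.\<close>
  proof (rule complete_imp_closed, rule completeI)
    fix k assume k: "\<forall>n. k n \<in> V ` M" "Cauchy k"
    have "\<forall>n. \<exists>F. F \<in> M \<and> k n = V F" using k(1) by auto
    from choice[OF this] obtain f where f: "\<And>n. f n \<in> M" "\<And>n. k n = V (f n)" by auto
    have iso: "dist (V X) (V X') = dist X X'" if "X \<in> M" "X' \<in> M" for X X'
      using that by (simp add: dist_norm hardy.subspace_diff[OF sub] norm_V flip: V_diff)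
    have "Cauchy f"
      using k(2) unfolding Cauchy_def f(2) by (simp add: iso f(1))
    then obtain F where F: "f \<longlonglongrightarrow> F" by (auto simp: Cauchy_convergent_iff convergent_def)
    have FM: "F \<in> M" using closed_sequentially[OF closed _ F] f(1) by blast
    have "k \<longlonglongrightarrow> V F"
      using F unfolding tendsto_dist_iff[of k] tendsto_dist_iff[of f] by (simp add: f iso FM)
    with FM show "\<exists>l\<in>V ` M. k \<longlonglongrightarrow> l" by blast
  qed
qed

theorem model:
  "\<exists>K. closed_bshift_invariant K \<and> hval ` M = (\<lambda>k z. fiber G J z (hval k z)) ` K \<and>
     (\<forall>k\<in>K. \<forall>F. hval F = (\<lambda>z. fiber G J z (hval k z)) \<longrightarrow> norm F = norm k)"
proof (intro exI conjI ballI allI impI)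
  have hval_eq: "hval F = (\<lambda>z. fiber G J z (hval (V F) z))" if "F \<in> M" for F
  proof
    fix z show "hval F z = fiber G J z (hval (V F) z)"
      using hval_V[OF that, of z] by (cases "z \<in> ball 0 1") (simp_all add: hval_outside fiber_def)
  qed
  show "closed_bshift_invariant (V ` M)" by (rule closed_bshift_invariant_V)
  show "hval ` M = (\<lambda>k z. fiber G J z (hval k z)) ` V ` M"
    unfolding image_image by (rule image_cong[OF refl hval_eq])
  fix k F assume "k \<in> V ` M" "hval F = (\<lambda>z. fiber G J z (hval k z))"
  \<comment> \<open>The norm identity is claimed for every \<open>F\<close> with these values;
    injectivity of \<open>hval\<close> identifies \<open>F\<close> with the element of
    \<open>M\<close> that produced \<open>k\<close>.\<close>
  then obtain F' where F': "F' \<in> M" "k = V F'" "hval F = hval F'"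
    using hval_eq by auto
  hence "F = F'" by (simp add: hval_inject)
  thus "norm F = norm k" using F' norm_V by simp
qed

end

text \<open>At 0 only the members outside \<open>J\<close> contribute, so independence of their
  values annihilates those entries of \<open>hval k 0\<close>. Splitting \<open>k\<close> into its
  value at 0 and \<open>z\<close> times its backward shift then exhibits \<open>F\<close> as
  \<open>z\<close> times a defect vector plus \<open>z\<close> times the element of \<open>M\<close>
  represented by the shifted \<open>k\<close>.\<close>

theorem model_imp_near:
  fixes G :: "'q::finite \<Rightarrow> 'm::finite hardy"
  assumes K: "hbshift ` K \<subseteq> K" and M: "hval ` M = (\<lambda>k z. fiber G J z (hval k z)) ` K"
    and indep: "\<And>v. (\<Sum>j\<in>- J. v j *s hval (G j) 0) = 0 \<Longrightarrow> \<forall>j\<in>- J. v j = 0"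
    and F: "F \<in> M" "hval F 0 = 0"
  shows "\<exists>F'\<in>M. \<exists>v. hbshift F = F' + (\<Sum>j\<in>J. hscale (v j) (G j))"
proof -
  obtain k where k: "k \<in> K" "hval F = (\<lambda>z. fiber G J z (hval k z))"
    using M F(1) by blast
  define v where "v j = hval k 0 $ j" for j
  have "hbshift k \<in> K" using K k(1) by blast
  then obtain F' where F': "F' \<in> M" "hval F' = (\<lambda>z. fiber G J z (hval (hbshift k) z))"
    using M by (metis (no_types, lifting) image_iff)
  have "(\<Sum>j\<in>- J. v j *s hval (G j) 0) = fiber G J 0 (hval k 0)"
    unfolding fiber_def v_def
    by (rule sum.mono_neutral_cong_left) auto
  also have "\<dots> = 0" using F(2) k(2) by simp
  finally have v0: "v j = 0" if "j \<notin> J" for j using indep[of v] that by blast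
  have "F = hshift (F' + (\<Sum>j\<in>J. hscale (v j) (G j)))"
  proof (rule hval_inject[THEN iffD1], rule ext)
    fix z
    show "hval F z = hval (hshift (F' + (\<Sum>j\<in>J. hscale (v j) (G j)))) z"
    proof (cases "z \<in> ball 0 1")
      case True
      have "fiber G J z (hval k 0) = (\<Sum>j\<in>J. (z * v j) *s hval (G j) z)"
        unfolding fiber_def
        by (rule sum.mono_neutral_cong_right) (use v0 in \<open>auto simp: v_def\<close>)
      hence "hval F z = z *s (\<Sum>j\<in>J. v j *s hval (G j) z) + z *s hval F' z"
        using hval_hbshift[OF True, of k]
        by (simp add: k(2) F'(2) fiber_add fiber_scale vec.scale_sum_right vector_smult_assoc)
      thus ?thesis
        by (simp add: hval_hshift hval_add hval_sum hval_scale vector_add_ldistrib add.commute)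
    qed (simp add: hval_outside)
  qed
  thus ?thesis using F'(1) hbshift_hshift by metis
qed

section \<open>The two representations\<close>

lemma hval_hcomp: "hval (hcomp f K) z = (\<chi> i. hval K z $ f i)"
  by (simp add: hcomp.rep_eq)

lemma hcoeff_hcomp: "hcoeff (hcomp f K) = (\<lambda>n. \<chi> i. hcoeff K n $ f i)"
proof (rule hcoeff_eqI)
  show "has_taylor (hval (hcomp f K)) (\<lambda>n. \<chi> i. hcoeff K n $ f i)"
    unfolding has_taylor_def sums_vec_iff
  proof (intro ballI allI)
    fix z :: complex and i assume "z \<in> ball 0 1"
    from sums_vec_nth[OF hval_sums[OF this, of K], of "f i"]
    show "(\<lambda>k. (z ^ k *s (\<chi> i. hcoeff K k $ f i)) $ i) sums (hval (hcomp f K) z $ i)"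
      by (simp add: hval_hcomp)
  qed
qed

lemma norm_vec_power2: "(norm (v :: complex ^ 'n))\<^sup>2 = (\<Sum>i\<in>UNIV. (cmod (v $ i))\<^sup>2)"
  by (simp add: norm_vec_def L2_set_def sum_nonneg)

lemma norm_hcomponents_sums:
  "(\<lambda>n. \<Sum>j\<in>I. (cmod (hcoeff k n $ j))\<^sup>2) sums (\<Sum>j\<in>I. (norm (hcomponent j k))\<^sup>2)"
proof (rule sums_sum)
  fix j
  show "(\<lambda>n. (cmod (hcoeff k n $ j))\<^sup>2) sums (norm (hcomponent j k))\<^sup>2"
    using norm_hardy_sums[of "hcomponent j k"]
    by (simp add: hcomponent_def hcoeff_hcomp norm_vec_power2)
qed

lemma norm_hardy_components: "(norm k)\<^sup>2 = (\<Sum>j\<in>UNIV. (norm (hcomponent j k))\<^sup>2)"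
  using sums_unique2[OF norm_hardy_sums[of k, unfolded norm_vec_power2] norm_hcomponents_sums] .

lemma sum_UNIV_Plus:
  "(\<Sum>j\<in>(UNIV :: ('r::finite + 'p::finite) set). f j) = (\<Sum>j\<in>UNIV. f (Inl j)) + (\<Sum>j\<in>UNIV. f (Inr j))"
  by (subst UNIV_Plus_UNIV[symmetric], subst sum.Plus) (simp_all add: o_def)

lemma norm_hardy_Plus:
  "(norm k)\<^sup>2 = (norm (hcomp Inl k))\<^sup>2 + (\<Sum>j\<in>UNIV. (norm (hcomponent (Inr j) k))\<^sup>2)"
proof -
  have "hcomponent j (hcomp Inl k) = hcomponent (Inl j) k" for j
    by (rule hardy_eqI) (simp add: hcomponent_def hcoeff_hcomp)
  thus ?thesis
    by (simp add: norm_hardy_components[of k] norm_hardy_components[of "hcomp Inl k"] sum_UNIV_Plus)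
qed

lemma rep_nonvanishing_eq_fiber:
  fixes W :: "'r::finite \<Rightarrow> 'm::finite hardy" and E :: "'p::finite \<Rightarrow> 'm hardy"
  shows "rep_nonvanishing W E = (\<lambda>k z. fiber (case_sum W E) (range Inr) z (hval k z))"
proof (intro ext)
  fix k :: "('r + 'p) hardy" and z
  have "columns_matrix W z *v hval (hcomp Inl k) z = (\<Sum>j\<in>UNIV. hval k z $ Inl j *s hval (W j) z)"
    by (simp add: vec_eq_iff matrix_vector_mult_def columns_matrix_def hval_hcomp mult.commute)
  thus "rep_nonvanishing W E k z = fiber (case_sum W E) (range Inr) z (hval k z)"
    by (simp add: rep_nonvanishing_def fiber_def sum_UNIV_Plus hcomponent_def hval_hcomp image_iff)
qed

lemma rep_vanishing_eq_fiber: "rep_vanishing E = (\<lambda>k z. fiber E UNIV z (hval k z))"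
  by (simp add: fun_eq_iff rep_vanishing_def fiber_def hcomponent_def hval_hcomp)

section \<open>Orthonormal bases of the defect space and of \<open>W\<close>\<close>

lemma horth_basis_orthonormal_family: "horth_basis E D \<Longrightarrow> orthonormal_family E"
  by unfold_locales (simp add: horth_basis_def)

lemma horth_basis_mem: "horth_basis E D \<Longrightarrow> E j \<in> D"
  unfolding horth_basis_def using hardy.span_base by blast

lemma hproj_horth_basis:
  assumes "horth_basis E D" "H \<in> D"
  shows "hproj E UNIV H = H"
proof -
  have "hardy.subspace {H. hproj E UNIV H = H}"
    by (rule hardy.subspaceI) (simp_all add: hproj_add hproj_scale hproj_eq_0)
  moreover have "range E \<subseteq> {H. hproj E UNIV H = H}"
    using assms(1)
    by (auto simp: hproj_def horth_basis_def if_distrib[of "\<lambda>a. hscale a _"] cong: if_cong)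
  ultimately have "hardy.span (range E) \<subseteq> {H. hproj E UNIV H = H}" by (intro hardy.span_minimal)
  thus ?thesis using assms by (auto simp: horth_basis_def)
qed

lemma horth_basis_dim:
  fixes E :: "'p::finite \<Rightarrow> 'm::finite hardy"
  assumes "horth_basis E D"
  shows "hardy.dim D = CARD('p)"
proof -
  have ON: "hinner (E i) (E j) = (if i = j then 1 else 0)" for i j
    using assms by (simp add: horth_basis_def)
  have "inj E"
  proof (rule injI)
    fix i j assume "E i = E j"
    thus "i = j" using ON[of i i] ON[of i j] by (auto split: if_splits)
  qed
  moreover have "hardy.independent (range E)"
  proof (rule hardy.independent_if_scalars_zero)
    fix f x assume 0: "(\<Sum>x\<in>range E. hscale (f x) x) = 0" and "x \<in> range E"
    then obtain i where i: "x = E i" by blast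
    have "0 = hinner (\<Sum>j\<in>UNIV. hscale (f (E j)) (E j)) (E i)"
      using 0 by (simp add: sum.reindex[OF \<open>inj E\<close>])
    also have "\<dots> = f x"
      by (simp add: i hinner_sum_left hinner_scale_left ON if_distrib[of "(*) _"] cong: if_cong)
    finally show "f x = 0" by simp
  qed simp
  ultimately show ?thesis
    using assms hardy.dim_span_eq_card_independent[of "range E"]
    by (simp add: horth_basis_def card_image)
qed

text \<open>Since \<open>D\<close> is orthogonal to \<open>M\<close>, the projection onto
  \<open>D\<close> annihilates the component in \<open>M\<close> and fixes the one in
  \<open>D\<close>; the difference is therefore the component in \<open>M\<close>, whichever
  orthonormal basis was chosen.\<close>

lemma defect_decomposition:
  assumes "defect_space M D p" "horth_basis E D" "F \<in> M" "hval F 0 = 0"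
  shows "hbshift F - hproj E UNIV (hbshift F) \<in> M"
proof -
  obtain A H where AH: "hbshift F = A + H" "A \<in> M" "H \<in> D"
    using assms unfolding defect_space_def by blast
  have "hproj E UNIV A = 0"
    using assms(1) horth_basis_mem[OF assms(2)] AH(2)
    by (intro hproj_eq_0) (auto simp: defect_space_def horthogonal_def)
  thus ?thesis using AH hproj_horth_basis[OF assms(2)] by (simp add: hproj_add)
qed

text \<open>The functions in \<open>M\<close> vanishing at 0 form a closed subspace
  \<open>N\<close>, by continuity of evaluation. Removing the projection \<open>P\<close> onto
  \<open>N\<close> from \<open>F\<close> leaves a vector in the span of \<open>W\<close> that is
  orthogonal to every \<open>W j\<close>, so \<open>F = P\<close>.\<close>

lemma hval_0_eq_0_if_orthogonal:
  fixes M :: "'m::finite hardy set"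
  assumes M: "hardy.subspace M" "closed M"
    and W: "horth_basis W (M \<ominus> (M \<inter> range hshift))"
    and F: "F \<in> M" "\<And>j. hinner F (W j) = 0"
  shows "hval F 0 = 0"
proof -
  define N where "N = M \<inter> range hshift"
  have N: "N = {F \<in> M. hval F 0 = 0}" by (auto simp: N_def range_hshift)
  have subN: "hardy.subspace N"
    using M(1) unfolding N hardy.subspace_def by (simp add: hval_add hval_scale)
  have "closed N"
  proof (rule closed_sequential_limits[THEN iffD2], intro allI impI, elim conjE)
    fix x l assume x: "\<forall>n. x n \<in> N" "x \<longlonglongrightarrow> l"
    have "l \<in> M" using closed_sequentially[OF M(2) _ x(2)] x(1) by (simp add: N)
    moreover have "norm (hval l 0) \<le> 0"
    proof (rule LIMSEQ_le_const)
      show "(\<lambda>n. norm (x n - l)) \<longlonglongrightarrow> 0"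
        using x(2) by (simp add: tendsto_norm_zero_iff LIM_zero_iff)
      have "norm (hval l 0) \<le> norm (x n - l)" for n
        using norm_hcoeff_le[of "x n - l" 0] x(1) by (simp add: hcoeff_0 hval_diff N)
      thus "\<exists>n0. \<forall>n\<ge>n0. norm (hval l 0) \<le> norm (x n - l)" by blast
    qed
    ultimately show "l \<in> N" by (simp add: N)
  qed
  then obtain P where P: "P \<in> N" "\<And>X. X \<in> N \<Longrightarrow> inner (F - P) X = 0"
    using Hilbert_projection[of N F] subspace_if_complex_subspace[OF subN] complete_eq_closed by blast
  have "hinner (F - P) X = 0" if "X \<in> N" for X
    unfolding hinner_eq_Complex using P(2) that hardy.subspace_scale[OF subN that]
    by (simp add: complex_eq_iff)
  moreover have "F - P \<in> M" using F(1) P(1) hardy.subspace_diff[OF M(1)] by (simp add: N)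
  ultimately have FP: "F - P \<in> M \<ominus> N" by (simp add: hominus_def)
  have "hinner (F - P) (W j) = 0" for j
  proof -
    have "hinner (W j) P = 0"
      using horth_basis_mem[OF W, of j] P(1) by (simp add: hominus_def N_def)
    thus ?thesis using F(2)[of j] hinner_commute[of P "W j"] by (simp add: hinner_diff_left)
  qed
  hence "F - P = 0"
    using hproj_horth_basis[OF W, of "F - P"] FP hproj_eq_0[of UNIV "F - P" W] by (simp add: N_def)
  thus ?thesis using P(1) by (simp add: N)
qed

text \<open>A combination of the \<open>W j\<close> that vanishes at 0 lies in the part of
  \<open>M\<close> to which every \<open>W i\<close> is orthogonal, and orthonormality recovers its
  coefficients as zero.\<close>

lemma hval_0_independent:
  fixes W :: "'r::finite \<Rightarrow> 'm::finite hardy"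
  assumes M: "hardy.subspace M" and W: "horth_basis W (M \<ominus> (M \<inter> range hshift))"
    and v: "(\<Sum>j\<in>UNIV. v j *s hval (W j) 0) = 0"
  shows "v i = 0"
proof -
  define X where "X = (\<Sum>j\<in>UNIV. hscale (v j) (W j))"
  have Wj: "W j \<in> M" for j using horth_basis_mem[OF W, of j] by (simp add: hominus_def)
  have "X \<in> M" unfolding X_def by (intro hardy.subspace_sum hardy.subspace_scale M Wj)
  moreover have "hval X 0 = 0" using v by (simp add: X_def hval_sum hval_scale)
  ultimately have "X \<in> M \<inter> range hshift" by (simp add: range_hshift)
  hence "hinner (W i) X = 0"
    using horth_basis_mem[OF W, of i] by (simp add: hominus_def)
  moreover have "hinner X (W i) = v i"
    using W by (simp add: X_def hinner_sum_left hinner_scale_left horth_basis_def if_distrib[of "(*) _"] cong: if_cong)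
  ultimately show ?thesis using hinner_commute[of X "W i"] by simp
qed

lemma nearly_invariant_defectI:
  fixes E :: "'p::finite \<Rightarrow> 'm::finite hardy"
  assumes "hardy.subspace M" "closed M" "horthogonal M D" "horth_basis E D"
    and near: "\<And>F. F \<in> M \<Longrightarrow> hval F 0 = 0 \<Longrightarrow> \<exists>F'\<in>M. \<exists>v. hbshift F = F' + (\<Sum>j\<in>UNIV. hscale (v j) (E j))"
  shows "nearly_invariant_defect M CARD('p)"
  unfolding nearly_invariant_defect_def
proof (intro conjI exI)
  have D: "hardy.span (range E) = D" using assms(4) by (simp add: horth_basis_def)
  show "defect_space M D CARD('p)"
    unfolding defect_space_def
  proof (intro conjI ballI impI)
    show "\<exists>B. finite B \<and> hardy.span B = D" using D by (intro exI[of _ "range E"]) simp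
    fix F assume "F \<in> M" "hval F 0 = 0"
    from near[OF this] obtain F' v where
      F': "F' \<in> M" "hbshift F = F' + (\<Sum>j\<in>UNIV. hscale (v j) (E j))" by blast
    moreover have "(\<Sum>j\<in>UNIV. hscale (v j) (E j)) \<in> D"
      unfolding D[symmetric] by (intro hardy.span_sum hardy.span_scale hardy.span_base rangeI)
    ultimately show "hbshift F \<in> {G + H |G H. G \<in> M \<and> H \<in> D}" by blast
  qed (use assms horth_basis_dim in auto)
qed (use assms in auto)

lemma near_invariance_nonvanishing:
  fixes E :: "'p::finite \<Rightarrow> 'm::finite hardy" and W :: "'r::finite \<Rightarrow> 'm hardy"
  assumes M: "hardy.subspace M" "closed M" and D: "defect_space M D CARD('p)" "horth_basis E D"
    and W: "horth_basis W (M \<ominus> (M \<inter> range hshift))"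
  shows "near_invariance (case_sum W E) M (range Inr)"
proof
  have WM: "W j \<in> M" for j using horth_basis_mem[OF W, of j] by (simp add: hominus_def)
  have ME: "hinner F (E j) = 0" if "F \<in> M" for F j
    using D that horth_basis_mem[OF D(2)] by (auto simp: defect_space_def horthogonal_def)
  show "hinner (case_sum W E i) (case_sum W E j) = (if i = j then 1 else 0)" for i j
    using W D(2) ME[OF WM] hinner_commute[of "E _" "W _"]
    by (cases i; cases j) (simp_all add: horth_basis_def)
  show "hinner F (case_sum W E j) = 0" if "F \<in> M" "j \<in> range Inr" for F j
    using that ME by auto
  show "case_sum W E j \<in> M" if "j \<notin> range Inr" for j
    using that WM by (cases j) auto
  show "hval F 0 = 0" if "F \<in> M" "\<And>j. j \<notin> range Inr \<Longrightarrow> hinner F (case_sum W E j) = 0" for F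
    using hval_0_eq_0_if_orthogonal[OF M W that(1)] that(2)[of "Inl _"] by auto
  show "hbshift F - hproj (case_sum W E) (range Inr) (hbshift F) \<in> M"
    if "F \<in> M" "hval F 0 = 0" for F
  proof -
    have "hproj (case_sum W E) (range Inr) X = hproj E UNIV X" for X
      by (simp add: hproj_def sum.reindex)
    thus ?thesis using defect_decomposition[OF D that] by simp
  qed
qed (use M in auto)

text \<open>With \<open>J = UNIV\<close> the family consists of the defect basis alone, so the
  locale conditions on indices outside \<open>J\<close> are vacuous, and vanishing at 0 holds on all
  of \<open>M\<close>.\<close>

lemma near_invariance_vanishing:
  fixes E :: "'p::finite \<Rightarrow> 'm::finite hardy"
  assumes M: "hardy.subspace M" "closed M" and D: "defect_space M D CARD('p)" "horth_basis E D"
    and 0: "\<forall>F\<in>M. hval F 0 = 0"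
  shows "near_invariance E M UNIV"
proof -
  interpret orthonormal_family E by (rule horth_basis_orthonormal_family[OF D(2)])
  show ?thesis
  proof
    show "hinner F (E j) = 0" if "F \<in> M" for F j
      using D that horth_basis_mem[OF D(2)] by (auto simp: defect_space_def horthogonal_def)
  qed (use M 0 defect_decomposition[OF D] in auto)
qed

text \<open>The representations compare sets of value functions, so the equality also asserts that
  every represented function lies in the Hardy space and belongs to \<open>M\<close>.\<close>

theorem theorem3p5:
  fixes M D :: "'m::finite hardy set"
    and E :: "'p::finite \<Rightarrow> 'm hardy"
    and W :: "'r::finite \<Rightarrow> 'm hardy"
  assumes "hardy.subspace M" and "closed M"
  shows
    "(defect_space M D CARD('p) \<and> horth_basis E D \<longrightarrow>
        (horth_basis W (M \<ominus> (M \<inter> range hshift)) \<and> (\<exists>F\<in>M. hval F 0 \<noteq> 0) \<longrightarrow>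
          (\<exists>K :: ('r + 'p) hardy set. closed_bshift_invariant K \<and>
            hval ` M = rep_nonvanishing W E ` K \<and>
            (\<forall>k\<in>K. \<forall>F. hval F = rep_nonvanishing W E k \<longrightarrow>
              (norm F)\<^sup>2 =
                (norm (hcomp Inl k))\<^sup>2 + (\<Sum>j\<in>UNIV. (norm (hcomponent (Inr j) k))\<^sup>2)))) \<and>
        ((\<forall>F\<in>M. hval F 0 = 0) \<longrightarrow>
          (\<exists>K :: 'p hardy set. closed_bshift_invariant K \<and>
            hval ` M = rep_vanishing E ` K \<and>
            (\<forall>k\<in>K. \<forall>F. hval F = rep_vanishing E k \<longrightarrow>
              (norm F)\<^sup>2 = (\<Sum>j\<in>UNIV. (norm (hcomponent j k))\<^sup>2))))) \<and>
     (horthogonal M D \<and> horth_basis E D \<and>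
        (horth_basis W (M \<ominus> (M \<inter> range hshift)) \<and> (\<exists>F\<in>M. hval F 0 \<noteq> 0) \<and>
           (\<exists>K :: ('r + 'p) hardy set. closed_bshift_invariant K \<and>
             hval ` M = rep_nonvanishing W E ` K) \<or>
         (\<forall>F\<in>M. hval F 0 = 0) \<and>
           (\<exists>K :: 'p hardy set. closed_bshift_invariant K \<and>
             hval ` M = rep_vanishing E ` K)) \<longrightarrow>
        nearly_invariant_defect M CARD('p))"
    (is "(?defect \<longrightarrow> (?nonvan \<longrightarrow> ?rep1) \<and> (?van \<longrightarrow> ?rep2)) \<and> (?orth \<and> ?basis \<and> ?rep \<longrightarrow> ?near)")
proof (intro conjI impI)
  assume D: ?defect
  \<comment> \<open>Once the component norms are collected into the norm of \<open>k\<close>, the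
    squared identity is the equality of norms from the model.\<close>
  show ?rep1 if ?nonvan
    using near_invariance.model[OF near_invariance_nonvanishing[OF assms _ _ _, of D E W]] D that
    by (simp only: rep_nonvanishing_eq_fiber norm_hardy_Plus[symmetric] power2_eq_iff_nonneg norm_ge_zero)
  show ?rep2 if ?van
    using near_invariance.model[OF near_invariance_vanishing[OF assms _ _ that, of D E]] D
    by (simp only: rep_vanishing_eq_fiber norm_hardy_components[symmetric] power2_eq_iff_nonneg norm_ge_zero)
next
  assume asm: "?orth \<and> ?basis \<and> ?rep"
  hence DE: "horthogonal M D" "horth_basis E D" and rep: ?rep by blast+
  show ?near
  proof (rule nearly_invariant_defectI[OF assms DE])
    fix F assume F: "F \<in> M" "hval F 0 = 0"
    from rep show "\<exists>F'\<in>M. \<exists>v. hbshift F = F' + (\<Sum>j\<in>UNIV. hscale (v j) (E j))"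
    proof (elim disjE conjE exE)
      fix K :: "('r + 'p) hardy set"
      assume W: "horth_basis W (M \<ominus> (M \<inter> range hshift))"
        and K: "closed_bshift_invariant K" "hval ` M = rep_nonvanishing W E ` K"
      have "\<exists>F'\<in>M. \<exists>v. hbshift F = F' + (\<Sum>j\<in>range Inr. hscale (v j) (case_sum W E j))"
      proof (rule model_imp_near[OF _ _ _ F])
        show "hbshift ` K \<subseteq> K" using K(1) by (simp add: closed_bshift_invariant_def)
        show "hval ` M = (\<lambda>k z. fiber (case_sum W E) (range Inr) z (hval k z)) ` K"
          using K(2) by (simp add: rep_nonvanishing_eq_fiber)
        fix v :: "'r + 'p \<Rightarrow> complex"
        have range_Inl: "- range Inr = range (Inl :: 'r \<Rightarrow> 'r + 'p)"
          by (auto simp: image_iff) (metis sum.exhaust)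
        assume "(\<Sum>j\<in>- range Inr. v j *s hval (case_sum W E j) 0) = 0"
        thus "\<forall>j\<in>- range Inr. v j = 0"
          using hval_0_independent[OF assms(1) W, of "v \<circ> Inl"]
          by (simp add: range_Inl sum.reindex o_def)
      qed
      then obtain F' v
        where "F' \<in> M" "hbshift F = F' + (\<Sum>j\<in>range Inr. hscale (v j) (case_sum W E j))"
        by blast
      thus ?thesis by (intro bexI[of _ F'] exI[of _ "v \<circ> Inr"]) (simp_all add: sum.reindex)
    next
      fix K :: "'p hardy set"
      assume K: "closed_bshift_invariant K" "hval ` M = rep_vanishing E ` K"
      show ?thesis
        \<comment> \<open>The independence condition concerns the complement of \<open>UNIV\<close>
          and is vacuous.\<close>
        by (rule model_imp_near[OF _ _ _ F, of K E UNIV])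
           (use K in \<open>simp_all add: closed_bshift_invariant_def rep_vanishing_eq_fiber\<close>)
    qed
  qed
qed

end
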